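(* Let $n\ge 2$ and let $\mathcal{F}$ be a positive-dimensional convex family of proper holomorphic maps from $B_n$ to $B_N$ (no boundary regularity is assumed). Assume that $f(0)=0$ for all $f\in\mathcal{F}$. Then $N\ge n+2$. Thus, for $n\ge 2$, there is no one-dimensional convex family of origin-preserving proper maps from $B_n$ to $B_{n+1}$.
   Context: $B_n$ is the open unit ball in $\mathbb{C}^n$ and $\|\cdot\|$ is the Euclidean norm. Two proper holomorphic maps $f,g$ from $B_n$ to possibly different balls are norm-equivalent if $\|f\|^2=\|g\|^2$ as functions on $B_n$; norm-equivalent maps are identified. A real-valued real-analytic function $R(z,\bar z)$ on $B_n$ belongs to $\mathcal{P}_\infty$ if $R=\|f\|^2$ for some holomorphic map $f$ on $B_n$ with values in a Hilbert space (here always finite-dimensional). Writing $R(z,\bar z)=\sum_{\alpha,\beta}c_{\alpha\beta}z^\alpha\bar z^\beta$, the Hermitian matrix $(c_{\alpha\beta})$ is called the underlying Hermitian form of $R$. Convex families: a zero-dimensional family is a single proper map. For $k\ge 1$, let $f_i:B_n\to B_{N_i}$, $1\le i\le k+1$, be proper holomorphic maps whose squared norms $\|f_i\|^2$ define linearly independent Hermitian forms. For $\lambda\in\mathbb{R}^k$ put $$R_\lambda=\sum_{j=1}^k\lambda_j\|f_j\|^2+\Big(1-\sum_{j=1}^k\lambda_j\Big)\|f_{k+1}\|^2,$$ and let $K\subset\mathbb{R}^k$ be the largest convex set such that $\lambda\in K$ implies $R_\lambda\in\mathcal{P}_\infty$. The $k$-dimensional convex family determined by these data consists of the proper maps $f$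 (up to norm equivalence) with $\|f\|^2=R_\lambda$ for some $\lambda\in K$. It is a family of maps from $B_n$ to $B_N$ if every member is (up to norm equivalence) a map from $B_n$ to $B_N$. *)

theory Defs
  imports "HOL-Analysis.Analysis"
begin

text \<open>
  The source is \<open>complex ^ 'n\<close>, so \<open>n = CARD('n)\<close> and \<open>B\<^sub>n\<close> is \<open>ball 0 1\<close>. Since target dimensions
  vary inside the statements, \<open>C\<^sup>N\<close> is the set of sequences \<open>w :: nat \<Rightarrow> complex\<close> vanishing from
  index \<open>N\<close> on. The product topology of \<open>nat \<Rightarrow> complex\<close> induces the Euclidean topology on it.
  A map on \<open>B\<^sub>n\<close> is a total function of which only the restriction to \<open>ball 0 1\<close> matters.
\<close>

type_synonym 'n mapping = "complex ^ 'n \<Rightarrow> nat \<Rightarrow> complex"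

definition cspace :: "nat \<Rightarrow> (nat \<Rightarrow> complex) set" where
  "cspace N = {w. \<forall>j\<ge>N. w j = 0}"

text \<open>On each \<^term>\<open>cspace N\<close> this series is the finite sum over \<open>j < N\<close>.\<close>

definition norm_sq :: "(nat \<Rightarrow> complex) \<Rightarrow> real" where
  "norm_sq w = (\<Sum>j. (cmod (w j))\<^sup>2)"

definition target_ball :: "nat \<Rightarrow> (nat \<Rightarrow> complex) set" where
  "target_ball N = {w \<in> cspace N. norm_sq w < 1}"

text \<open>Holomorphy in several variables: the real Frechet derivative exists and is complex-linear.\<close>

definition holomorphic_fun_on :: "(complex ^ 'n::finite \<Rightarrow> complex) \<Rightarrow> (complex ^ 'n) set \<Rightarrow> bool" where
  "holomorphic_fun_on h S \<longleftrightarrow>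
     (\<forall>z\<in>S. \<exists>L. (h has_derivative L) (at z) \<and> (\<forall>c v. L (c *s v) = c * L v))"

definition holomorphic_ball_map :: "nat \<Rightarrow> 'n::finite mapping \<Rightarrow> bool" where
  "holomorphic_ball_map N f \<longleftrightarrow>
     f ` ball 0 1 \<subseteq> cspace N \<and> (\<forall>j<N. holomorphic_fun_on (\<lambda>z. f z j) (ball 0 1))"

definition proper_holomorphic :: "nat \<Rightarrow> 'n::finite mapping \<Rightarrow> bool" where
  "proper_holomorphic N f \<longleftrightarrow>
     holomorphic_ball_map N f \<and> f ` ball 0 1 \<subseteq> target_ball N \<and>
     proper_map (top_of_set (ball 0 1)) (top_of_set (target_ball N)) f"

definition norm_equivalent :: "'n::finite mapping \<Rightarrow> 'n mapping \<Rightarrow> bool" where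
  "norm_equivalent f g \<longleftrightarrow> (\<forall>z\<in>ball 0 1. norm_sq (f z) = norm_sq (g z))"

definition P_infinity :: "(complex ^ 'n::finite \<Rightarrow> real) \<Rightarrow> bool" where
  "P_infinity R \<longleftrightarrow>
     (\<exists>N f. holomorphic_ball_map N f \<and> (\<forall>z\<in>ball 0 1. R z = norm_sq (f z)))"

definition monomial :: "complex ^ 'n::finite \<Rightarrow> ('n \<Rightarrow> nat) \<Rightarrow> complex" where
  "monomial z \<alpha> = (\<Prod>i\<in>UNIV. (z $ i) ^ \<alpha> i)"

text \<open>
  The matrix \<open>c\<close> of the expansion of \<open>R\<close> in \<open>z\<close> and its conjugate at the origin. Unordered
  convergence near the origin determines \<open>c\<close> uniquely.
\<close>

definition underlying_form ::
  "(complex ^ 'n::finite \<Rightarrow> real) \<Rightarrow> ('n \<Rightarrow> nat) \<Rightarrow> ('n \<Rightarrow> nat) \<Rightarrow> complex" where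
  "underlying_form R = (THE c. \<exists>r>0. \<forall>z\<in>ball 0 r.
     ((\<lambda>(\<alpha>, \<beta>). c \<alpha> \<beta> * monomial z \<alpha> * cnj (monomial z \<beta>)) has_sum complex_of_real (R z)) UNIV)"

definition independent_forms :: "('i::finite \<Rightarrow> 'n::finite mapping) \<Rightarrow> bool" where
  "independent_forms f \<longleftrightarrow>
     (\<forall>a :: 'i \<Rightarrow> real.
        (\<forall>\<alpha> \<beta>. (\<Sum>i\<in>UNIV. of_real (a i) * underlying_form (\<lambda>z. norm_sq (f i z)) \<alpha> \<beta>) = 0)
        \<longrightarrow> (\<forall>i. a i = 0))"

text \<open>
  The \<open>k + 1\<close> defining maps of a family of dimension \<open>k = CARD('k) \<ge> 1\<close> are indexed by
  \<open>'k option\<close>; \<^term>\<open>None\<close> stands for the last index \<open>k + 1\<close>.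
\<close>

definition family_fun ::
  "('k::finite option \<Rightarrow> 'n::finite mapping) \<Rightarrow> real ^ 'k \<Rightarrow> complex ^ 'n \<Rightarrow> real" where
  "family_fun f t z =
     (\<Sum>j\<in>UNIV. t $ j * norm_sq (f (Some j) z)) + (1 - (\<Sum>j\<in>UNIV. t $ j)) * norm_sq (f None z)"

text \<open>
  The greatest element with respect to inclusion exists: sums and nonnegative multiples of squared
  norms are squared norms, so the set of all admissible \<open>t\<close> is itself convex.
\<close>

definition parameter_set ::
  "('k::finite option \<Rightarrow> 'n::finite mapping) \<Rightarrow> (real ^ 'k) set" where
  "parameter_set f = (GREATEST K. convex K \<and> (\<forall>t\<in>K. P_infinity (family_fun f t)))"

text \<open>A family contains all representatives of each of its norm equivalence classes.\<close>

definition family_members ::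
  "('k::finite option \<Rightarrow> 'n::finite mapping) \<Rightarrow> 'n mapping set" where
  "family_members f =
     {g. (\<exists>M. proper_holomorphic M g) \<and>
         (\<exists>t\<in>parameter_set f. \<forall>z\<in>ball 0 1. norm_sq (g z) = family_fun f t z)}"

definition convex_family :: "'k::finite itself \<Rightarrow> 'n::finite mapping set \<Rightarrow> bool" where
  "convex_family k F \<longleftrightarrow>
     (\<exists>f :: 'k option \<Rightarrow> 'n mapping.
        (\<forall>i. \<exists>M. proper_holomorphic M (f i)) \<and> independent_forms f \<and> F = family_members f)"

definition maps_to_ball :: "nat \<Rightarrow> 'n::finite mapping set \<Rightarrow> bool" where
  "maps_to_ball N F \<longleftrightarrow> (\<forall>f\<in>F. \<exists>g. proper_holomorphic N g \<and> norm_equivalent f g)"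

definition origin_preserving :: "'n::finite mapping set \<Rightarrow> bool" where
  "origin_preserving F \<longleftrightarrow> (\<forall>f\<in>F. \<forall>j. f 0 j = 0)"

end

theory Submission
  imports Defs "HOL-Complex_Analysis.Conformal_Mappings"
begin

text \<open>
  Let \<open>f\<close> and \<open>g\<close> be two of the defining maps. The midpoint \<open>(\<parallel>f\<parallel>\<^sup>2 + \<parallel>g\<parallel>\<^sup>2) / 2\<close> is again the squared
  norm of a member \<open>h\<close> of the family. Suppose that \<open>N < n + 2\<close>; then \<open>f\<close>, \<open>g\<close>, \<open>h\<close> can be taken with
  values in \<open>C\<^sup>m\<close>, \<open>m = n + 1\<close>, and \<open>2 \<parallel>h\<parallel>\<^sup>2 = \<parallel>f\<parallel>\<^sup>2 + \<parallel>g\<parallel>\<^sup>2\<close>. The contradiction is that \<open>\<parallel>f\<parallel> = \<parallel>g\<parallel>\<close>.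

  Polarizing the identity gives linear maps with \<open>f = A h\<close> and \<open>g = B h\<close> (\<open>averaged_maps_factor\<close>), so
  that \<open>\<parallel>f\<parallel>\<^sup>2 - \<parallel>g\<parallel>\<^sup>2 = q(h)\<close> for the Hermitian form \<open>q(x) = \<parallel>A x\<parallel>\<^sup>2 - \<parallel>B x\<parallel>\<^sup>2\<close> on \<open>C\<^sup>m\<close>. As
  \<open>f\<close> and \<open>g\<close> are proper, \<open>q(h) \<rightarrow> 0\<close> and \<open>\<parallel>h\<parallel>\<^sup>2 \<rightarrow> 1\<close> at the unit sphere.

  The analytic tool is a maximum principle (\<open>signed_squares_maximum_principle\<close>): a combination
  \<open>G = \<Sum> \<sigma>\<^sub>i \<bar>\<phi>\<^sub>i\<bar>\<^sup>2\<close> of squares of holomorphic functions, with signs, is bounded by its boundary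
  values as soon as its Levi form \<open>v \<mapsto> \<Sum> \<sigma>\<^sub>i \<bar>d\<phi>\<^sub>i(v)\<bar>\<^sup>2\<close> is nonnegative in some direction \<open>v \<noteq> 0\<close>
  at every point, since then \<open>G + e \<parallel>z\<parallel>\<^sup>2\<close> has no interior maximum for any \<open>e > 0\<close>. It is used
  twice, and counting dimensions supplies the direction \<open>v\<close> in both cases.

  If there are \<open>q\<close>-orthogonal \<open>x\<close>, \<open>y\<close> with \<open>q(x), q(y) < 0\<close>, then for large \<open>s\<close> the form
  \<open>- s q(u) - \<parallel>u\<parallel>\<^sup>2\<close> is nonnegative on the plane spanned by \<open>x\<close> and \<open>y\<close>. As \<open>n + 2 > m\<close>, the derivative
  of \<open>h\<close> maps some \<open>v \<noteq> 0\<close> into this plane, and the principle applies to \<open>G = - s q(h) - \<parallel>h\<parallel>\<^sup>2\<close>. But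
  \<open>G\<close> tends to \<open>-1\<close> at the sphere, whereas \<open>G(0) = 0\<close> because \<open>h(0) = 0\<close>: a contradiction.

  Otherwise \<open>q\<close> is nonnegative on the \<open>q\<close>-orthogonal complement of any \<open>x\<close> with \<open>q(x) < 0\<close>. That
  complement is cut out by one linear equation, so as \<open>n \<ge> 2\<close> the derivative of \<open>h\<close> maps some
  \<open>v \<noteq> 0\<close> into it. The principle applies to \<open>q(h)\<close> itself and gives \<open>\<parallel>f\<parallel> \<le> \<parallel>g\<parallel>\<close>. By symmetry
  \<open>\<parallel>f\<parallel> = \<parallel>g\<parallel>\<close>, contrary to the linear independence of the underlying forms.
\<close>

section \<open>A maximum principle for signed sums of squared moduli\<close>

text \<open>
  The averages over \<open>t\<close>, \<open>\<i>t\<close>, \<open>-t\<close>, \<open>-\<i>t\<close> remove the linear terms and, up to the variation of the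
  remainders \<open>r\<^sub>k\<close>, also the pure quadratic ones; only \<open>\<bar>b\<bar>\<^sup>2 t\<^sup>2\<close> survives to second order.
\<close>

lemma four_point_mean_expansion:
  fixes a b r1 r2 r3 r4 :: complex and t :: real
  shows "(cmod (a + b * t + t\<^sup>2 * r1))\<^sup>2 + (cmod (a + b * (\<i> * t) - t\<^sup>2 * r2))\<^sup>2
       + (cmod (a - b * t + t\<^sup>2 * r3))\<^sup>2 + (cmod (a - b * (\<i> * t) - t\<^sup>2 * r4))\<^sup>2 - 4 * (cmod a)\<^sup>2
     = t\<^sup>2 * (4 * (cmod b)\<^sup>2 + 2 * Re (cnj a * (r1 - r2 + r3 - r4))
         + 2 * t * Re (cnj b * (r1 + \<i> * r2 - r3 - \<i> * r4))
         + t\<^sup>2 * ((cmod r1)\<^sup>2 + (cmod r2)\<^sup>2 + (cmod r3)\<^sup>2 + (cmod r4)\<^sup>2))"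
proof -
  have of: "complex_of_real t ^ 2 = of_real (t ^ 2)" by simp
  show ?thesis
    unfolding cmod_power2 of by (simp add: power2_eq_square) algebra
qed

text \<open>
  A discrete form of \<open>\<Delta> \<bar>\<psi>\<bar>\<^sup>2 = 4 \<bar>\<psi>'\<bar>\<^sup>2\<close>, in which the Laplacian is replaced by a quotient that is
  nonpositive at a maximum by inspection.
\<close>

lemma four_point_mean_tendsto:
  assumes hol: "\<psi> holomorphic_on S" and S: "open S" "0 \<in> S"
  shows "((\<lambda>t::real. ((cmod (\<psi> t))\<^sup>2 + (cmod (\<psi> (\<i> * t)))\<^sup>2 + (cmod (\<psi> (- of_real t)))\<^sup>2
            + (cmod (\<psi> (- (\<i> * t))))\<^sup>2 - 4 * (cmod (\<psi> 0))\<^sup>2) / t\<^sup>2)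
          \<longlongrightarrow> 4 * (cmod (deriv \<psi> 0))\<^sup>2) (at_right 0)"
proof -
  define a where "a = \<psi> 0"
  define b where "b = deriv \<psi> 0"
  \<comment> \<open>The second order Taylor remainder \<open>r\<close> comes from dividing out the zero twice.\<close>
  define d1 where "d1 = (\<lambda>\<zeta>. if \<zeta> = 0 then deriv \<psi> 0 else (\<psi> \<zeta> - \<psi> 0) / (\<zeta> - 0))"
  define r where "r = (\<lambda>\<zeta>. if \<zeta> = 0 then deriv d1 0 else (d1 \<zeta> - d1 0) / (\<zeta> - 0))"
  have "d1 holomorphic_on S"
    unfolding d1_def by (rule pole_lemma_open[OF hol S(1)])
  then have "r holomorphic_on S"
    unfolding r_def by (rule pole_lemma_open[OF _ S(1)])
  then have cont: "isCont r 0"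
    using S holomorphic_on_imp_continuous_on continuous_on_eq_continuous_at by blast
  have \<psi>: "\<psi> \<zeta> = a + b * \<zeta> + \<zeta>\<^sup>2 * r \<zeta>" for \<zeta>
    by (auto simp: a_def b_def r_def d1_def field_simps power2_eq_square)
  have lim: "((\<lambda>t::real. r (w * t)) \<longlongrightarrow> r 0) (at_right 0)" for w
  proof (rule isCont_tendsto_compose[OF cont])
    have "((\<lambda>t::real. w * complex_of_real t) \<longlongrightarrow> w * complex_of_real 0) (at_right 0)"
      by (intro tendsto_intros)
    then show "((\<lambda>t::real. w * complex_of_real t) \<longlongrightarrow> 0) (at_right 0)" by simp
  qed
  have *: "((\<lambda>t::real. 4 * (cmod b)\<^sup>2
          + 2 * Re (cnj a * (r (1 * of_real t) - r (\<i> * t) + r ((-1) * of_real t) - r ((-\<i>) * t)))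
          + 2 * t * Re (cnj b * (r (1 * of_real t) + \<i> * r (\<i> * t) - r ((-1) * of_real t) - \<i> * r ((-\<i>) * t)))
          + t\<^sup>2 * ((cmod (r (1 * of_real t)))\<^sup>2 + (cmod (r (\<i> * t)))\<^sup>2 + (cmod (r ((-1) * of_real t)))\<^sup>2
             + (cmod (r ((-\<i>) * t)))\<^sup>2))
      \<longlongrightarrow> 4 * (cmod b)\<^sup>2 + 2 * Re (cnj a * (r 0 - r 0 + r 0 - r 0))
          + 2 * 0 * Re (cnj b * (r 0 + \<i> * r 0 - r 0 - \<i> * r 0))
          + 0\<^sup>2 * ((cmod (r 0))\<^sup>2 + (cmod (r 0))\<^sup>2 + (cmod (r 0))\<^sup>2 + (cmod (r 0))\<^sup>2)) (at_right 0)"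
    by (intro tendsto_intros lim)
  have "\<forall>\<^sub>F t::real in at_right 0. 4 * (cmod b)\<^sup>2
          + 2 * Re (cnj a * (r (1 * of_real t) - r (\<i> * t) + r ((-1) * of_real t) - r ((-\<i>) * t)))
          + 2 * t * Re (cnj b * (r (1 * of_real t) + \<i> * r (\<i> * t) - r ((-1) * of_real t) - \<i> * r ((-\<i>) * t)))
          + t\<^sup>2 * ((cmod (r (1 * of_real t)))\<^sup>2 + (cmod (r (\<i> * t)))\<^sup>2 + (cmod (r ((-1) * of_real t)))\<^sup>2
             + (cmod (r ((-\<i>) * t)))\<^sup>2)
      = ((cmod (\<psi> t))\<^sup>2 + (cmod (\<psi> (\<i> * t)))\<^sup>2 + (cmod (\<psi> (- of_real t)))\<^sup>2
            + (cmod (\<psi> (- (\<i> * t))))\<^sup>2 - 4 * (cmod (\<psi> 0))\<^sup>2) / t\<^sup>2"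
  proof (rule eventually_at_rightI[of 0 1])
    fix t :: real assume t: "t \<in> {0<..<1}"
    have psi: "\<psi> t = a + b * t + t\<^sup>2 * r (1 * of_real t)" "\<psi> (\<i> * t) = a + b * (\<i> * t) - t\<^sup>2 * r (\<i> * t)"
      "\<psi> (- of_real t) = a - b * t + t\<^sup>2 * r ((-1) * of_real t)" "\<psi> (- (\<i> * t)) = a - b * (\<i> * t) - t\<^sup>2 * r ((-\<i>) * t)"
      by (subst \<psi>; simp add: power_mult_distrib)+
    show "4 * (cmod b)\<^sup>2
          + 2 * Re (cnj a * (r (1 * of_real t) - r (\<i> * t) + r ((-1) * of_real t) - r ((-\<i>) * t)))
          + 2 * t * Re (cnj b * (r (1 * of_real t) + \<i> * r (\<i> * t) - r ((-1) * of_real t) - \<i> * r ((-\<i>) * t)))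
          + t\<^sup>2 * ((cmod (r (1 * of_real t)))\<^sup>2 + (cmod (r (\<i> * t)))\<^sup>2 + (cmod (r ((-1) * of_real t)))\<^sup>2
             + (cmod (r ((-\<i>) * t)))\<^sup>2)
      = ((cmod (\<psi> t))\<^sup>2 + (cmod (\<psi> (\<i> * t)))\<^sup>2 + (cmod (\<psi> (- of_real t)))\<^sup>2
            + (cmod (\<psi> (- (\<i> * t))))\<^sup>2 - 4 * (cmod (\<psi> 0))\<^sup>2) / t\<^sup>2"
      unfolding psi a_def[symmetric] four_point_mean_expansion using t by simp
  qed simp
  from Lim_transform_eventually[OF * this] show ?thesis
    by (simp add: b_def)
qed

text \<open>
  The derivative in the definition of holomorphy is unique, so it may be replaced by
  \<^const>\<open>frechet_derivative\<close>.
\<close>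

lemma frechet_derivative_holomorphic:
  assumes "holomorphic_fun_on \<phi> S" "z \<in> S"
  shows "(\<phi> has_derivative frechet_derivative \<phi> (at z)) (at z)"
    and "frechet_derivative \<phi> (at z) (c *s v) = c * frechet_derivative \<phi> (at z) v"
proof -
  obtain L where L: "(\<phi> has_derivative L) (at z)" "\<forall>c v. L (c *s v) = c * L v"
    using assms unfolding holomorphic_fun_on_def by blast
  have eq: "frechet_derivative \<phi> (at z) = L"
    using frechet_derivative_at[OF L(1)] by simp
  show "(\<phi> has_derivative frechet_derivative \<phi> (at z)) (at z)"
    "frechet_derivative \<phi> (at z) (c *s v) = c * frechet_derivative \<phi> (at z) v"
    using L eq by auto
qed

lemma has_derivative_line:
  fixes z v :: "complex ^ 'n::finite"
  shows "((\<lambda>\<zeta>. z + \<zeta> *s v) has_derivative (\<lambda>c. c *s v)) (at \<zeta>)"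
proof -
  have "bounded_linear (\<lambda>c::complex. c *s v)"
  proof (rule bounded_linear_intro)
    show "(a + b) *s v = a *s v + b *s v" for a b by (simp add: vec.scale_left_distrib)
    show "(r *\<^sub>R x) *s v = r *\<^sub>R (x *s v)" for r x by (simp add: vec_eq_iff)
    show "norm (x *s v) \<le> norm x * norm v" for x
      by (simp add: norm_vec_def L2_set_def norm_mult power_mult_distrib
          flip: sum_distrib_left real_sqrt_mult) (simp add: real_sqrt_mult)
  qed
  then show ?thesis
    by (auto intro!: derivative_eq_intros bounded_linear.has_derivative[of _ "\<lambda>x. x", simplified])
qed

lemma has_field_derivative_slice:
  assumes hol: "holomorphic_fun_on \<phi> S" and "z + \<zeta> *s v \<in> S"
  shows "((\<lambda>\<zeta>. \<phi> (z + \<zeta> *s v)) has_field_derivative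
            frechet_derivative \<phi> (at (z + \<zeta> *s v)) v) (at \<zeta>)"
proof -
  note D = frechet_derivative_holomorphic[OF assms]
  have "((\<lambda>\<zeta>. \<phi> (z + \<zeta> *s v)) has_derivative
      (\<lambda>c. frechet_derivative \<phi> (at (z + \<zeta> *s v)) (c *s v))) (at \<zeta>)"
    by (rule has_derivative_compose[OF has_derivative_line D(1)])
  then show ?thesis
    by (simp add: has_field_derivative_def D(2) mult.commute[of _ "frechet_derivative _ _ _"])
qed

lemma norm_sq_vec: "(norm z)\<^sup>2 = (\<Sum>j\<in>UNIV. (cmod (z $ j))\<^sup>2)" for z :: "complex ^ 'n::finite"
  by (simp add: norm_vec_def L2_set_def sum_nonneg)

text \<open>
  On the complex line through \<open>w\<close> in the direction \<open>v\<close>, the Laplacian at \<open>w\<close> of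
  \<open>\<Sum> \<sigma>\<^sub>i \<bar>\<phi>\<^sub>i\<bar>\<^sup>2 + e \<parallel>z\<parallel>\<^sup>2\<close> is four times its Levi form at \<open>v\<close>, and this is at least \<open>e \<parallel>v\<parallel>\<^sup>2 > 0\<close>;
  at a maximum the Laplacian would be nonpositive.
\<close>

lemma signed_squares_not_maximal:
  fixes \<phi> :: "'i::finite \<Rightarrow> complex ^ 'n::finite \<Rightarrow> complex" and \<sigma> :: "'i \<Rightarrow> real"
  assumes hol: "\<And>i. holomorphic_fun_on (\<phi> i) S" and S: "open S" "w \<in> S"
    and v: "v \<noteq> 0" and levi: "0 \<le> (\<Sum>i\<in>UNIV. \<sigma> i * (cmod (frechet_derivative (\<phi> i) (at w) v))\<^sup>2)"
    and e: "e > 0"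
  shows "\<exists>z\<in>S. (\<Sum>i\<in>UNIV. \<sigma> i * (cmod (\<phi> i w))\<^sup>2) + e * (norm w)\<^sup>2
           < (\<Sum>i\<in>UNIV. \<sigma> i * (cmod (\<phi> i z))\<^sup>2) + e * (norm z)\<^sup>2"
proof (rule ccontr)
  assume contra: "\<not> ?thesis"
  define T where "T = {\<zeta>. w + \<zeta> *s v \<in> S}"
  define \<psi> where "\<psi> = (\<lambda>i \<zeta>. \<phi> i (w + \<zeta> *s v))"
  \<comment> \<open>The coordinates on the line: \<open>\<parallel>z\<parallel>\<^sup>2\<close> is itself a sum of squared moduli of holomorphic functions.\<close>
  define \<xi> where "\<xi> = (\<lambda>j \<zeta>. w $ j + \<zeta> * v $ j)"
  define U where "U = (\<lambda>\<zeta>. (\<Sum>i\<in>UNIV. \<sigma> i * (cmod (\<psi> i \<zeta>))\<^sup>2) + e * (\<Sum>j\<in>UNIV. (cmod (\<xi> j \<zeta>))\<^sup>2))"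
  define av where "av = (\<lambda>(f::complex\<Rightarrow>real) (t::real).
     (f t + f (\<i> * t) + f (- of_real t) + f (- (\<i> * t)) - 4 * f 0) / t\<^sup>2)"
  have cont: "isCont (\<lambda>\<zeta>. w + \<zeta> *s v) \<zeta>" for \<zeta>
    using has_derivative_line has_derivative_continuous by blast
  have T: "open T" "0 \<in> T"
    using open_vimage[OF S(1), of "\<lambda>\<zeta>. w + \<zeta> *s v"] cont S(2)
    by (auto simp: T_def vimage_def continuous_at_imp_continuous_on)
  have der\<psi>: "(\<psi> i has_field_derivative frechet_derivative (\<phi> i) (at (w + \<zeta> *s v)) v) (at \<zeta>)"
    if "\<zeta> \<in> T" for i \<zeta>
    using has_field_derivative_slice[OF hol] that unfolding \<psi>_def T_def by blast
  have der\<xi>: "(\<xi> j has_field_derivative v $ j) (at \<zeta>)" for j \<zeta>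
    unfolding \<xi>_def by (auto intro!: derivative_eq_intros)
  have hol\<psi>: "\<psi> i holomorphic_on T" for i
    unfolding holomorphic_on_def field_differentiable_def
    using der\<psi> has_field_derivative_at_within by blast
  have hol\<xi>: "\<xi> j holomorphic_on T" for j
    unfolding holomorphic_on_def field_differentiable_def
    using der\<xi> has_field_derivative_at_within by blast
  have lim\<psi>: "(av (\<lambda>\<zeta>. (cmod (\<psi> i \<zeta>))\<^sup>2) \<longlongrightarrow> 4 * (cmod (frechet_derivative (\<phi> i) (at w) v))\<^sup>2) (at_right 0)" for i
    using four_point_mean_tendsto[OF hol\<psi> T] DERIV_imp_deriv[OF der\<psi>[OF T(2)]]
    by (simp add: av_def)
  have lim\<xi>: "(av (\<lambda>\<zeta>. (cmod (\<xi> j \<zeta>))\<^sup>2) \<longlongrightarrow> 4 * (cmod (v $ j))\<^sup>2) (at_right 0)" for j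
    using four_point_mean_tendsto[OF hol\<xi> T] DERIV_imp_deriv[OF der\<xi>]
    by (simp add: av_def)
  have avU: "av U = (\<lambda>t. (\<Sum>i\<in>UNIV. \<sigma> i * av (\<lambda>\<zeta>. (cmod (\<psi> i \<zeta>))\<^sup>2) t)
      + e * (\<Sum>j\<in>UNIV. av (\<lambda>\<zeta>. (cmod (\<xi> j \<zeta>))\<^sup>2) t))"
    unfolding av_def U_def
    by (simp add: fun_eq_iff sum_distrib_left sum_divide_distrib sum.distrib sum_subtractf
        add_divide_distrib diff_divide_distrib algebra_simps)
  have "(av U \<longlongrightarrow> (\<Sum>i\<in>UNIV. \<sigma> i * (4 * (cmod (frechet_derivative (\<phi> i) (at w) v))\<^sup>2))
      + e * (\<Sum>j\<in>UNIV. 4 * (cmod (v $ j))\<^sup>2)) (at_right 0)"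
    unfolding avU by (intro tendsto_intros lim\<psi> lim\<xi>)
  moreover have "\<forall>\<^sub>F t in at_right 0. av U t \<le> 0"
  proof -
    have ev: "\<forall>\<^sub>F t::real in at_right 0. c * of_real t \<in> T" for c
    proof (rule topological_tendstoD[OF _ T])
      have "((\<lambda>t::real. c * of_real t) \<longlongrightarrow> c * of_real 0) (at_right 0)"
        by (intro tendsto_intros)
      then show "((\<lambda>t::real. c * of_real t) \<longlongrightarrow> 0) (at_right 0)" by simp
    qed
    have le: "U \<zeta> \<le> U 0" if "\<zeta> \<in> T" for \<zeta>
      using contra that by (auto simp: U_def \<psi>_def \<xi>_def T_def norm_sq_vec not_less)
    show ?thesis
      using ev[of 1] ev[of \<i>] ev[of "-1"] ev[of "-\<i>"]
    proof eventually_elim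
      case (elim t)
      have "U t + U (\<i> * t) + U (- of_real t) + U (- (\<i> * t)) - 4 * U 0 \<le> 0"
        using le[OF elim(1)] le[OF elim(2)] le[OF elim(3)] le[OF elim(4)] by simp
      then show ?case
        by (simp add: av_def divide_nonpos_nonneg)
    qed
  qed
  ultimately have "(\<Sum>i\<in>UNIV. \<sigma> i * (4 * (cmod (frechet_derivative (\<phi> i) (at w) v))\<^sup>2))
      + e * (\<Sum>j\<in>UNIV. 4 * (cmod (v $ j))\<^sup>2) \<le> 0"
    by (intro tendsto_upperbound) auto
  moreover have "(\<Sum>i\<in>UNIV. \<sigma> i * (4 * (cmod (frechet_derivative (\<phi> i) (at w) v))\<^sup>2))
      + e * (\<Sum>j\<in>UNIV. 4 * (cmod (v $ j))\<^sup>2)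
      = 4 * (\<Sum>i\<in>UNIV. \<sigma> i * (cmod (frechet_derivative (\<phi> i) (at w) v))\<^sup>2) + 4 * e * (norm v)\<^sup>2"
    by (simp add: norm_sq_vec sum_distrib_left algebra_simps)
  moreover have "e * (norm v)\<^sup>2 > 0"
    using e v by simp
  ultimately show False using levi by linarith
qed

lemma holomorphic_fun_on_continuous:
  assumes "holomorphic_fun_on \<phi> S"
  shows "continuous_on S \<phi>"
  using frechet_derivative_holomorphic(1)[OF assms] has_derivative_continuous
  by (blast intro: continuous_at_imp_continuous_on)

text \<open>
  The direction \<open>v\<close> may depend on the point in any way, and the Levi form may be very negative in
  other directions. If the bound \<open>c\<close> failed at \<open>z\<close>, a small multiple of \<open>\<parallel>z\<parallel>\<^sup>2\<close> could be added
  without moving the maximum to the sphere.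
\<close>

lemma signed_squares_maximum_principle:
  fixes \<phi> :: "'i::finite \<Rightarrow> complex ^ 'n::finite \<Rightarrow> complex" and \<sigma> :: "'i \<Rightarrow> real"
  assumes hol: "\<And>i. holomorphic_fun_on (\<phi> i) (ball 0 1)"
    and levi: "\<And>z. z \<in> ball 0 1 \<Longrightarrow>
      \<exists>v. v \<noteq> 0 \<and> 0 \<le> (\<Sum>i\<in>UNIV. \<sigma> i * (cmod (frechet_derivative (\<phi> i) (at z) v))\<^sup>2)"
    and bdry: "\<And>e. e > 0 \<Longrightarrow> \<exists>r<1. \<forall>z\<in>ball 0 1. r < norm z \<longrightarrow>
      (\<Sum>i\<in>UNIV. \<sigma> i * (cmod (\<phi> i z))\<^sup>2) < c + e"
    and z: "z \<in> ball 0 1"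
  shows "(\<Sum>i\<in>UNIV. \<sigma> i * (cmod (\<phi> i z))\<^sup>2) \<le> c"
proof (rule ccontr)
  define G where "G = (\<lambda>z. \<Sum>i\<in>UNIV. \<sigma> i * (cmod (\<phi> i z))\<^sup>2)"
  assume "\<not> ?thesis"
  then have gt: "G z > c" by (simp add: G_def)
  \<comment> \<open>Near the sphere \<open>G + e \<parallel>x\<parallel>\<^sup>2\<close> stays below \<open>c + 2 e = G z\<close>.\<close>
  define e where "e = (G z - c) / 2"
  have e: "e > 0" using gt by (simp add: e_def)
  obtain r0 where r0: "r0 < 1" "\<And>x. x \<in> ball 0 1 \<Longrightarrow> r0 < norm x \<Longrightarrow> G x < c + e"
    using bdry[OF e] unfolding G_def by blast
  define r where "r = max r0 (norm z)"
  have r: "r < 1" "norm z \<le> r" "r0 \<le> r"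
    using r0 z by (auto simp: r_def)
  define H where "H = (\<lambda>x. G x + e * (norm x)\<^sup>2)"
  have sub: "cball 0 r \<subseteq> ball (0::complex^'n) 1" using r by auto
  have "continuous_on (cball 0 r) H"
    unfolding H_def G_def
    by (intro continuous_intros continuous_on_subset[OF holomorphic_fun_on_continuous[OF hol] sub])
  moreover have "cball 0 r \<noteq> ({}::(complex^'n) set)"
    using r(2) by (metis empty_iff mem_cball_0)
  ultimately obtain w where w: "w \<in> cball 0 r" "\<And>x. x \<in> cball 0 r \<Longrightarrow> H x \<le> H w"
    using continuous_attains_sup[OF compact_cball] by meson
  have max: "H x \<le> H w" if x: "x \<in> ball 0 1" for x
  proof (cases "norm x \<le> r")
    case True then show ?thesis using w by simp
  next
    case False
    then have "G x < c + e" using r0 r x by auto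
    moreover have "(norm x)\<^sup>2 \<le> 1" using x by (simp add: power_le_one)
    then have "e * (norm x)\<^sup>2 \<le> e" using e by simp
    moreover have "G z \<le> H z" using e by (simp add: H_def)
    moreover have "H z \<le> H w" using w r by simp
    ultimately show ?thesis
      by (simp add: H_def e_def field_simps)
  qed
  have wb: "w \<in> ball 0 1" using w sub by auto
  obtain v where "v \<noteq> 0" "0 \<le> (\<Sum>i\<in>UNIV. \<sigma> i * (cmod (frechet_derivative (\<phi> i) (at w) v))\<^sup>2)"
    using levi[OF wb] by blast
  from signed_squares_not_maximal[OF hol open_ball wb this e]
  show False using max unfolding H_def G_def by (meson not_less)
qed

section \<open>Polarization\<close>

text \<open>
  Set \<open>z(y) = p + y q\<close>, where \<open>z(-\<i>) = a\<close> and \<open>z(\<i>) = b\<close>. The one-variable function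
  \<open>F(y) = \<Sum> \<sigma>\<^sub>i \<phi>\<^sub>i(z(y)) cnj (\<phi>\<^sub>i(z(cnj y)))\<close> is holomorphic. For real \<open>y\<close> both arguments agree and
  \<open>F(y) = 0\<close> by hypothesis, so \<open>F\<close> vanishes identically; its value at \<open>-\<i>\<close> is the claim.
\<close>

lemma polarization:
  fixes \<phi> :: "'i::finite \<Rightarrow> complex ^ 'n::finite \<Rightarrow> complex" and \<sigma> :: "'i \<Rightarrow> real"
  assumes hol: "\<And>i. holomorphic_fun_on (\<phi> i) S" and S: "open S" "convex S"
    and zero: "\<And>z. z \<in> S \<Longrightarrow> (\<Sum>i\<in>UNIV. \<sigma> i * (cmod (\<phi> i z))\<^sup>2) = 0"
    and ab: "a \<in> S" "b \<in> S"
  shows "(\<Sum>i\<in>UNIV. of_real (\<sigma> i) * \<phi> i a * cnj (\<phi> i b)) = 0"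
proof -
  define p where "p = (1/2) *s (a + b)"
  define q where "q = (\<i>/2) *s (a - b)"
  define X where "X = {y. p + y *s q \<in> S}"
  define Y where "Y = X \<inter> {y. cnj y \<in> X}"
  define F where "F = (\<lambda>y. \<Sum>i\<in>UNIV. of_real (\<sigma> i) * \<phi> i (p + y *s q) * (cnj \<circ> (\<lambda>y. \<phi> i (p + y *s q)) \<circ> cnj) y)"
  have cont: "isCont (\<lambda>\<zeta>. p + \<zeta> *s q) \<zeta>" for \<zeta>
    using has_derivative_line has_derivative_continuous by blast
  have X: "open X"
    using open_vimage[OF S(1), of "\<lambda>\<zeta>. p + \<zeta> *s q"] cont
    by (auto simp: X_def vimage_def continuous_at_imp_continuous_on)
  have cX: "convex X"
    unfolding convex_def
  proof (intro ballI allI impI)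
    fix x y u v assume *: "x \<in> X" "y \<in> X" "0 \<le> (u::real)" "0 \<le> v" "u + v = 1"
    have "p + (u *\<^sub>R x + v *\<^sub>R y) *s q = u *\<^sub>R (p + x *s q) + v *\<^sub>R (p + y *s q)"
    proof -
      have "p = u *\<^sub>R p + v *\<^sub>R p" using *(5) by (metis scaleR_left_distrib scaleR_one)
      then show ?thesis
        by (simp add: vec_eq_iff algebra_simps)
    qed
    then show "u *\<^sub>R x + v *\<^sub>R y \<in> X"
      using * S(2) by (auto simp: X_def convex_def)
  qed
  have "(\<lambda>\<zeta>. \<phi> i (p + \<zeta> *s q)) holomorphic_on X" for i
    unfolding holomorphic_on_def field_differentiable_def X_def
    using has_field_derivative_slice[OF hol] has_field_derivative_at_within by blast
  note holX = this
  have Xc: "open {y. cnj y \<in> X}" "convex {y. cnj y \<in> X}"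
    using open_vimage[OF X, of cnj] convex_linear_vimage[OF linear_cnj cX]
    by (simp_all add: vimage_def)
  have holc: "(cnj \<circ> (\<lambda>y. \<phi> i (p + y *s q)) \<circ> cnj) holomorphic_on {y. cnj y \<in> X}" for i
    by (rule holomorphic_on_compose_cnj_cnj[OF holomorphic_on_subset[OF holX] Xc(1)]) auto
  have F: "F holomorphic_on Y"
    unfolding F_def Y_def
    by (intro holomorphic_intros holomorphic_on_subset[OF holX] holomorphic_on_subset[OF holc]) auto
  have Y: "open Y" "convex Y"
    unfolding Y_def using X cX Xc by (auto intro!: open_Int convex_Int)
  have i: "p + \<i> *s q = b" "p + (-\<i>) *s q = a"
    by (simp_all add: p_def q_def vec_eq_iff field_simps)
  have iY: "\<i> \<in> Y" "- \<i> \<in> Y"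
    using i ab by (auto simp: Y_def X_def)
  have "0 \<in> Y"
    using convexD_alt[OF Y(2) iY, of "1/2"] by simp
  have real0: "F (of_real x) = 0" if "of_real x \<in> Y" for x :: real
  proof -
    have "F (of_real x) = of_real (\<Sum>i\<in>UNIV. \<sigma> i * (cmod (\<phi> i (p + of_real x *s q)))\<^sup>2)"
      by (simp add: F_def complex_norm_square mult.assoc del: of_real_power)
    with zero that show ?thesis by (simp add: Y_def X_def)
  qed
  obtain d where d: "d > 0" "ball 0 d \<subseteq> Y"
    using Y(1) \<open>0 \<in> Y\<close> open_contains_ball by blast
  define U where "U = complex_of_real ` {0<..<d}"
  have lim: "(0::complex) islimpt U"
    unfolding islimpt_approachable
  proof (intro allI impI)
    fix e :: real assume "e > 0"
    with d show "\<exists>x'\<in>U. x' \<noteq> 0 \<and> dist x' (0::complex) < e"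
      unfolding U_def bex_simps by (intro bexI[of _ "min d e / 2"]) (auto simp: dist_norm)
  qed
  have "U \<subseteq> Y" using d by (auto simp: U_def subset_iff)
  have "F (-\<i>) = 0"
    by (rule analytic_continuation[OF F Y(1) convex_connected[OF Y(2)] \<open>U \<subseteq> Y\<close> \<open>0 \<in> Y\<close> lim _ iY(2)])
      (use real0 \<open>U \<subseteq> Y\<close> in \<open>auto simp: U_def\<close>)
  then show ?thesis
    using i by (simp add: F_def)
qed

section \<open>Maps whose squared norms have a common average\<close>

definition herm :: "complex ^ 'm::finite \<Rightarrow> complex ^ 'm \<Rightarrow> complex" where
  "herm x y = (\<Sum>i\<in>UNIV. x $ i * cnj (y $ i))"

lemma herm_add_left: "herm (x + y) z = herm x z + herm y z"
  and herm_add_right: "herm z (x + y) = herm z x + herm z y"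
  and herm_scale_left: "herm (c *s x) z = c * herm x z"
  and herm_scale_right: "herm z (c *s x) = cnj c * herm z x"
  and cnj_herm: "cnj (herm x z) = herm z x"
  by (simp_all add: herm_def sum.distrib sum_distrib_left algebra_simps)

lemma herm_self: "herm x x = of_real ((norm x)\<^sup>2)"
  by (simp add: herm_def norm_sq_vec complex_norm_square del: of_real_power)

lemma herm_sum_left: "herm (\<Sum>i\<in>T. x i) z = (\<Sum>i\<in>T. herm (x i) z)"
  by (induction T rule: infinite_finite_induct)
    (simp_all add: herm_add_left, simp_all add: herm_def)

lemma herm_sum_right: "herm z (\<Sum>i\<in>T. x i) = (\<Sum>i\<in>T. herm z (x i))"
  by (induction T rule: infinite_finite_induct) (simp_all add: herm_add_right, simp_all add: herm_def)

lemma herm_combination: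
  "herm (\<Sum>i\<in>T. c i *s x i) (\<Sum>j\<in>T. c j *s x j) = (\<Sum>i\<in>T. \<Sum>j\<in>T. c i * cnj (c j) * herm (x i) (x j))"
  by (subst herm_sum_left, subst herm_sum_right) (simp add: herm_scale_left herm_scale_right mult_ac)


text \<open>
  Prescribe \<open>A\<close> on a basis consisting of values of \<open>h\<close>. Every other value of \<open>h\<close> is a combination of
  the basis, which is a linear relation among values of \<open>h\<close> and therefore carries over to \<open>E\<close>.
\<close>

lemma linear_factorization:
  fixes h :: "'a \<Rightarrow> complex ^ 'm::finite" and E :: "'a \<Rightarrow> complex ^ 'p::finite"
  assumes rel: "\<And>T c. finite T \<Longrightarrow> T \<subseteq> S \<Longrightarrow> (\<Sum>z\<in>T. c z *s h z) = 0 \<Longrightarrow> (\<Sum>z\<in>T. c z *s E z) = 0"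
  shows "\<exists>A. \<forall>z\<in>S. E z = A *v h z"
proof -
  obtain B where B: "B \<subseteq> h ` S" "vec.independent B" "h ` S \<subseteq> vec.span B"
    by (rule vec.maximal_independent_subset[of "h ` S"])
  define k where "k = inv_into S h"
  have k: "k b \<in> S" "h (k b) = b" if "b \<in> B" for b
    using that B(1) by (auto simp: k_def inv_into_into f_inv_into_f)
  obtain L where L: "Vector_Spaces.linear (*s) (*s) L" "\<And>b. b \<in> B \<Longrightarrow> L b = E (k b)"
    using vec.linear_independent_extend[OF B(2), of "\<lambda>b. E (k b)"] by blast
  have finB: "finite B" using vec.finiteI_independent[OF B(2)] .
  have "E z = L (h z)" if z: "z \<in> S" for z
  proof -
    obtain c where c: "h z = (\<Sum>b\<in>B. c b *s b)"
      using B(3) z vec.span_finite[OF finB] by auto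
    have inj: "inj_on k B" by (metis inj_onI k(2))
    have Lh: "L (h z) = (\<Sum>b\<in>B. c b *s E (k b))"
      unfolding c by (simp add: vec.linear_sum[OF L(1)] vec.linear_scale[OF L(1)] L(2))
    show ?thesis
    proof (cases "z \<in> k ` B")
      case True
      then obtain b where "b \<in> B" "z = k b" by blast
      then show ?thesis using k L(2) by simp
    next
      case False
      define d where "d = (\<lambda>w. if w = z then -1 else c (h w))"
      have "(\<Sum>w\<in>insert z (k ` B). d w *s X w) = - X z + (\<Sum>b\<in>B. c b *s X (k b))" for X :: "'a \<Rightarrow> complex ^ 'q::finite"
      proof -
        have "(\<Sum>w\<in>insert z (k ` B). d w *s X w) = d z *s X z + (\<Sum>w\<in>k ` B. d w *s X w)"
          using False finB by simp
        also have "(\<Sum>w\<in>k ` B. d w *s X w) = (\<Sum>b\<in>B. d (k b) *s X (k b))"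
          by (simp add: sum.reindex[OF inj])
        also have "\<dots> = (\<Sum>b\<in>B. c b *s X (k b))"
          using False k by (intro sum.cong) (auto simp: d_def)
        finally show ?thesis by (simp add: d_def)
      qed
      note eq = this
      have "(\<Sum>w\<in>insert z (k ` B). d w *s h w) = 0"
        unfolding eq using c k by simp
      then have "(\<Sum>w\<in>insert z (k ` B). d w *s E w) = 0"
        using rel[of "insert z (k ` B)" d] finB z k by auto
      then show ?thesis
        unfolding eq Lh by (simp add: add_eq_0_iff)
    qed
  qed
  then show ?thesis
    using matrix_works[OF L(1)] by metis
qed


lemma exists_kernel_vector:
  fixes T :: "'a::euclidean_space \<Rightarrow> 'b::euclidean_space"
  assumes "linear T" "DIM('b) < DIM('a)"
  shows "\<exists>v. v \<noteq> 0 \<and> T v = 0"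
proof (rule ccontr)
  assume "\<not> ?thesis"
  then have "inj T" using linear_injective_0[OF assms(1)] by blast
  then have "dim (range T) = DIM('a)"
    using dim_image_eq[OF assms(1), of UNIV] by (simp add: dim_UNIV)
  then show False using dim_subset_UNIV[of "range T"] assms(2) by simp
qed

definition holomorphic_vec_on :: "(complex ^ 'n::finite \<Rightarrow> complex ^ 'm::finite) \<Rightarrow> (complex ^ 'n) set \<Rightarrow> bool" where
  "holomorphic_vec_on f S \<longleftrightarrow> (\<forall>i. holomorphic_fun_on (\<lambda>z. f z $ i) S)"

definition vec_derivative :: "(complex ^ 'n::finite \<Rightarrow> complex ^ 'm::finite) \<Rightarrow> complex ^ 'n \<Rightarrow> complex ^ 'n \<Rightarrow> complex ^ 'm" where
  "vec_derivative f z v = (\<chi> i. frechet_derivative (\<lambda>z. f z $ i) (at z) v)"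

lemma linear_vec_derivative:
  assumes "holomorphic_vec_on f S" "z \<in> S"
  shows "linear (vec_derivative f z)"
proof -
  have "linear (frechet_derivative (\<lambda>z. f z $ i) (at z))" for i
    using frechet_derivative_holomorphic(1) assms has_derivative_linear
    unfolding holomorphic_vec_on_def by blast
  then show ?thesis
    by (auto simp: linear_iff vec_derivative_def vec_eq_iff)
qed

lemma vec_derivative_matrix_mult:
  fixes h :: "complex ^ 'n::finite \<Rightarrow> complex ^ 'm::finite" and A :: "complex ^ 'm ^ 'p::finite"
  assumes h: "holomorphic_vec_on h S" and S: "open S" "z \<in> S" and f: "\<And>w. w \<in> S \<Longrightarrow> f w = A *v h w"
  shows "vec_derivative f z v = A *v vec_derivative h z v"
proof -
  have dh: "((\<lambda>z. h z $ j) has_derivative frechet_derivative (\<lambda>z. h z $ j) (at z)) (at z)" for j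
    using frechet_derivative_holomorphic(1) h S unfolding holomorphic_vec_on_def by blast
  have "frechet_derivative (\<lambda>z. f z $ i) (at z) v = (\<Sum>j\<in>UNIV. A $ i $ j * frechet_derivative (\<lambda>z. h z $ j) (at z) v)" for i
  proof -
    have "((\<lambda>z. \<Sum>j\<in>UNIV. A $ i $ j * h z $ j) has_derivative
        (\<lambda>v. \<Sum>j\<in>UNIV. A $ i $ j * frechet_derivative (\<lambda>z. h z $ j) (at z) v)) (at z)"
      by (intro has_derivative_sum has_derivative_mult_right dh)
    then have "((\<lambda>z. f z $ i) has_derivative
        (\<lambda>v. \<Sum>j\<in>UNIV. A $ i $ j * frechet_derivative (\<lambda>z. h z $ j) (at z) v)) (at z)"
      by (rule has_derivative_transform_within_open[OF _ S]) (simp add: f matrix_vector_mult_def)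
    from fun_cong[OF frechet_derivative_at[OF this], of v] show ?thesis by (rule sym)
  qed
  then show ?thesis
    by (simp add: vec_derivative_def matrix_vector_mult_def)
qed

lemma sum_UNIV_sum: "(\<Sum>i\<in>UNIV. F i) = (\<Sum>i\<in>UNIV. F (Inl i)) + (\<Sum>i\<in>UNIV. F (Inr i))"
  for F :: "'a::finite + 'b::finite \<Rightarrow> 'c::comm_monoid_add"
  using sum.Plus[of UNIV UNIV F] by (simp add: UNIV_Plus_UNIV)

text \<open>
  The components of the three maps together form one family of functions, indexed by a sum type.
\<close>

lemma three_maps_maximum_principle:
  fixes f g h :: "complex ^ 'n::finite \<Rightarrow> complex ^ 'm::finite" and \<alpha> \<beta> \<gamma> :: real
  assumes hol: "holomorphic_vec_on f (ball 0 1)" "holomorphic_vec_on g (ball 0 1)"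
      "holomorphic_vec_on h (ball 0 1)"
    and levi: "\<And>z. z \<in> ball 0 1 \<Longrightarrow> \<exists>v. v \<noteq> 0 \<and> 0 \<le> \<alpha> * (norm (vec_derivative f z v))\<^sup>2
        + \<beta> * (norm (vec_derivative g z v))\<^sup>2 + \<gamma> * (norm (vec_derivative h z v))\<^sup>2"
    and bdry: "\<And>e. e > 0 \<Longrightarrow> \<exists>r<1. \<forall>z\<in>ball 0 1. r < norm z \<longrightarrow>
        \<alpha> * (norm (f z))\<^sup>2 + \<beta> * (norm (g z))\<^sup>2 + \<gamma> * (norm (h z))\<^sup>2 < c + e"
    and z: "z \<in> ball 0 1"
  shows "\<alpha> * (norm (f z))\<^sup>2 + \<beta> * (norm (g z))\<^sup>2 + \<gamma> * (norm (h z))\<^sup>2 \<le> c"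
proof -
  define \<phi> where "\<phi> = case_sum (\<lambda>i z. f z $ i) (case_sum (\<lambda>i z. g z $ i) (\<lambda>i z. h z $ i))"
  define \<sigma> where "\<sigma> = case_sum (\<lambda>i::'m. \<alpha>) (case_sum (\<lambda>i::'m. \<beta>) (\<lambda>i::'m. \<gamma>))"
  have val: "(\<Sum>i\<in>UNIV. \<sigma> i * (cmod (\<phi> i z))\<^sup>2)
      = \<alpha> * (norm (f z))\<^sup>2 + \<beta> * (norm (g z))\<^sup>2 + \<gamma> * (norm (h z))\<^sup>2" for z
    by (simp add: sum_UNIV_sum \<phi>_def \<sigma>_def norm_sq_vec sum_distrib_left)
  have der: "(\<Sum>i\<in>UNIV. \<sigma> i * (cmod (frechet_derivative (\<phi> i) (at z) v))\<^sup>2)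
      = \<alpha> * (norm (vec_derivative f z v))\<^sup>2 + \<beta> * (norm (vec_derivative g z v))\<^sup>2
        + \<gamma> * (norm (vec_derivative h z v))\<^sup>2" for z v
    by (simp add: sum_UNIV_sum \<phi>_def \<sigma>_def norm_sq_vec sum_distrib_left vec_derivative_def)
  have "holomorphic_fun_on (\<phi> i) (ball 0 1)" for i
    using hol by (auto simp: \<phi>_def holomorphic_vec_on_def split: sum.split)
  from signed_squares_maximum_principle[where \<phi> = \<phi> and \<sigma> = \<sigma> and c = c and z = z, OF this,
      unfolded val der, OF levi bdry z]
  show ?thesis .
qed

lemma three_maps_polarization:
  fixes f g h :: "complex ^ 'n::finite \<Rightarrow> complex ^ 'm::finite" and \<alpha> \<beta> \<gamma> :: real
  assumes hol: "holomorphic_vec_on f S" "holomorphic_vec_on g S" "holomorphic_vec_on h S"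
    and S: "open S" "convex S"
    and zero: "\<And>z. z \<in> S \<Longrightarrow> \<alpha> * (norm (f z))\<^sup>2 + \<beta> * (norm (g z))\<^sup>2 + \<gamma> * (norm (h z))\<^sup>2 = 0"
    and ab: "a \<in> S" "b \<in> S"
  shows "\<alpha> * herm (f a) (f b) + \<beta> * herm (g a) (g b) + \<gamma> * herm (h a) (h b) = 0"
proof -
  define \<phi> where "\<phi> = case_sum (\<lambda>i z. f z $ i) (case_sum (\<lambda>i z. g z $ i) (\<lambda>i z. h z $ i))"
  define \<sigma> where "\<sigma> = case_sum (\<lambda>i::'m. \<alpha>) (case_sum (\<lambda>i::'m. \<beta>) (\<lambda>i::'m. \<gamma>))"
  have val: "(\<Sum>i\<in>UNIV. \<sigma> i * (cmod (\<phi> i z))\<^sup>2)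
      = \<alpha> * (norm (f z))\<^sup>2 + \<beta> * (norm (g z))\<^sup>2 + \<gamma> * (norm (h z))\<^sup>2" for z
    by (simp add: sum_UNIV_sum \<phi>_def \<sigma>_def norm_sq_vec sum_distrib_left)
  have "holomorphic_fun_on (\<phi> i) S" for i
    using hol by (auto simp: \<phi>_def holomorphic_vec_on_def split: sum.split)
  from polarization[where \<phi> = \<phi> and \<sigma> = \<sigma>, OF this S _ ab]
  have "(\<Sum>i\<in>UNIV. of_real (\<sigma> i) * \<phi> i a * cnj (\<phi> i b)) = 0"
    unfolding val using zero by blast
  then show ?thesis
    by (simp add: sum_UNIV_sum \<phi>_def \<sigma>_def herm_def sum_distrib_left mult.assoc add.assoc)
qed

text \<open>
  By polarization, \<open>\<parallel>\<Sum> c\<^sub>z f(z)\<parallel>\<^sup>2 + \<parallel>\<Sum> c\<^sub>z g(z)\<parallel>\<^sup>2 = 2 \<parallel>\<Sum> c\<^sub>z h(z)\<parallel>\<^sup>2\<close> for all finite combinations,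
  so every linear relation between values of \<open>h\<close> holds for \<open>f\<close> and \<open>g\<close> too.
\<close>

lemma averaged_maps_factor:
  fixes f g h :: "complex ^ 'n::finite \<Rightarrow> complex ^ 'm::finite"
  assumes hol: "holomorphic_vec_on f S" "holomorphic_vec_on g S" "holomorphic_vec_on h S"
    and S: "open S" "convex S"
    and avg: "\<And>z. z \<in> S \<Longrightarrow> 2 * (norm (h z))\<^sup>2 = (norm (f z))\<^sup>2 + (norm (g z))\<^sup>2"
  obtains A B where "\<And>z. z \<in> S \<Longrightarrow> f z = A *v h z" "\<And>z. z \<in> S \<Longrightarrow> g z = B *v h z"
proof -
  have pol: "herm (f a) (f b) + herm (g a) (g b) = 2 * herm (h a) (h b)" if "a \<in> S" "b \<in> S" for a b
    using three_maps_polarization[OF hol S _ that, of 1 1 "-2"] avg by simp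
  have "(\<Sum>z\<in>T. c z *s f z) = 0 \<and> (\<Sum>z\<in>T. c z *s g z) = 0"
    if T: "T \<subseteq> S" and 0: "(\<Sum>z\<in>T. c z *s h z) = 0" for T c
  proof -
    have "herm (\<Sum>z\<in>T. c z *s f z) (\<Sum>z\<in>T. c z *s f z) + herm (\<Sum>z\<in>T. c z *s g z) (\<Sum>z\<in>T. c z *s g z)
        = (\<Sum>a\<in>T. \<Sum>b\<in>T. c a * cnj (c b) * (herm (f a) (f b) + herm (g a) (g b)))"
      by (simp add: herm_combination sum.distrib ring_distribs)
    also have "\<dots> = (\<Sum>a\<in>T. \<Sum>b\<in>T. c a * cnj (c b) * (2 * herm (h a) (h b)))"
      using T by (intro sum.cong refl arg_cong2[of _ _ _ _ "(*)"] pol) auto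
    also have "\<dots> = 2 * herm (\<Sum>z\<in>T. c z *s h z) (\<Sum>z\<in>T. c z *s h z)"
      by (simp add: herm_combination sum_distrib_left mult_ac)
    also have "\<dots> = 0" unfolding 0 by (simp add: herm_def)
    finally have "of_real ((norm (\<Sum>z\<in>T. c z *s f z))\<^sup>2 + (norm (\<Sum>z\<in>T. c z *s g z))\<^sup>2) = (0::complex)"
      by (simp add: herm_self)
    then have "(norm (\<Sum>z\<in>T. c z *s f z))\<^sup>2 + (norm (\<Sum>z\<in>T. c z *s g z))\<^sup>2 = 0"
      unfolding of_real_eq_0_iff .
    then show ?thesis
      by (simp add: sum_power2_eq_zero_iff)
  qed
  with linear_factorization[of S h f] linear_factorization[of S h g] that show ?thesis
    by meson
qed

text \<open>
  The hypothesis says that \<open>x\<close> and \<open>y\<close> are orthogonal for the form \<open>\<parallel>A u\<parallel>\<^sup>2 - \<parallel>B u\<parallel>\<^sup>2\<close>.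
\<close>

lemma difference_form_orthogonal:
  fixes A B :: "complex ^ 'm::finite ^ 'p::finite"
  assumes "herm (A *v x) (A *v y) = herm (B *v x) (B *v y)"
  shows "(norm (A *v (a *s x + b *s y)))\<^sup>2 - (norm (B *v (a *s x + b *s y)))\<^sup>2
    = (cmod a)\<^sup>2 * ((norm (A *v x))\<^sup>2 - (norm (B *v x))\<^sup>2)
    + (cmod b)\<^sup>2 * ((norm (A *v y))\<^sup>2 - (norm (B *v y))\<^sup>2)" (is "?l = ?r")
proof -
  have c: "herm (A *v y) (A *v x) = herm (B *v y) (B *v x)"
    using assms by (metis cnj_herm)
  have lin: "C *v (a *s x + b *s y) = a *s (C *v x) + b *s (C *v y)" for C :: "complex ^ 'm ^ 'p"
    by (simp add: vec.add vec.scale)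
  have "complex_of_real ?l = herm (A *v (a *s x + b *s y)) (A *v (a *s x + b *s y))
      - herm (B *v (a *s x + b *s y)) (B *v (a *s x + b *s y))"
    by (simp add: herm_self)
  also have "\<dots> = a * cnj a * (herm (A *v x) (A *v x) - herm (B *v x) (B *v x))
      + b * cnj b * (herm (A *v y) (A *v y) - herm (B *v y) (B *v y))"
    unfolding lin by (simp add: herm_add_left herm_add_right herm_scale_left herm_scale_right assms c algebra_simps)
  also have "\<dots> = complex_of_real ?r"
    by (simp add: herm_self complex_norm_square del: of_real_power)
  finally show ?thesis
    unfolding of_real_eq_iff .
qed

section \<open>Sphere-preserving maps into low dimension\<close>

text \<open>
  Properness of a map between balls in terms of norms: the image tends to the unit sphere
  whenever the argument does.
\<close>

definition sphere_preserving :: "(complex ^ 'n::finite \<Rightarrow> complex ^ 'm::finite) \<Rightarrow> bool" where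
  "sphere_preserving f \<longleftrightarrow> (\<forall>z\<in>ball 0 1. norm (f z) < 1) \<and>
     (\<forall>e>0. \<exists>r<1. \<forall>z\<in>ball 0 1. r < norm z \<longrightarrow> 1 - e < (norm (f z))\<^sup>2)"

lemma sphere_preserving_pair:
  assumes "sphere_preserving f" "sphere_preserving g" "e > 0"
  obtains r where "r < 1"
    "\<And>z. z \<in> ball 0 1 \<Longrightarrow> r < norm z \<Longrightarrow> 1 - e < (norm (f z))\<^sup>2 \<and> (norm (f z))\<^sup>2 < 1
        \<and> 1 - e < (norm (g z))\<^sup>2 \<and> (norm (g z))\<^sup>2 < 1"
proof -
  obtain r where "r < 1" "\<forall>z\<in>ball 0 1. r < norm z \<longrightarrow> 1 - e < (norm (f z))\<^sup>2"
    using assms(1,3) unfolding sphere_preserving_def by blast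
  moreover obtain s where "s < 1" "\<forall>z\<in>ball 0 1. s < norm z \<longrightarrow> 1 - e < (norm (g z))\<^sup>2"
    using assms(2,3) unfolding sphere_preserving_def by blast
  moreover have "(norm (f z))\<^sup>2 < 1" "(norm (g z))\<^sup>2 < 1" if "z \<in> ball 0 1" for z
    using assms that by (auto simp: sphere_preserving_def power_less_one_iff)
  ultimately show thesis using that[of "max r s"] by simp
qed

text \<open>
  The case distinction is whether the Hermitian form \<open>q\<close> with \<open>\<parallel>f\<parallel>\<^sup>2 - \<parallel>g\<parallel>\<^sup>2 = q(h)\<close> has negative
  index at least two, which is witnessed by two orthogonal negative vectors. If not, \<open>q\<close> is nonnegative
  on the orthogonal complement of any negative vector.
\<close>

lemma averaged_sphere_maps_norm_le:
  fixes f g h :: "complex ^ 'n::finite \<Rightarrow> complex ^ 'm::finite"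
  assumes n: "CARD('n) \<ge> 2" and m: "CARD('m) < CARD('n) + 2"
    and hol: "holomorphic_vec_on f (ball 0 1)" "holomorphic_vec_on g (ball 0 1)"
      "holomorphic_vec_on h (ball 0 1)"
    and sph: "sphere_preserving f" "sphere_preserving g"
    and avg: "\<And>z. z \<in> ball 0 1 \<Longrightarrow> 2 * (norm (h z))\<^sup>2 = (norm (f z))\<^sup>2 + (norm (g z))\<^sup>2"
    and h0: "h 0 = 0" and z: "z \<in> ball 0 1"
  shows "(norm (f z))\<^sup>2 \<le> (norm (g z))\<^sup>2"
proof -
  obtain A B where A: "\<And>z. z \<in> ball 0 1 \<Longrightarrow> f z = A *v h z" and B: "\<And>z. z \<in> ball 0 1 \<Longrightarrow> g z = B *v h z"
    using averaged_maps_factor[OF hol open_ball convex_ball avg] by blast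
  define q where "q = (\<lambda>x. (norm (A *v x))\<^sup>2 - (norm (B *v x))\<^sup>2)"
  define orth where "orth = (\<lambda>x y. herm (A *v x) (A *v y) = herm (B *v x) (B *v y))"
  have Df: "vec_derivative f z v = A *v vec_derivative h z v"
    and Dg: "vec_derivative g z v = B *v vec_derivative h z v" if "z \<in> ball 0 1" for z v
    using vec_derivative_matrix_mult[OF hol(3) open_ball that] A B by blast+
  have linD: "linear (vec_derivative h z)" if "z \<in> ball 0 1" for z
    using linear_vec_derivative[OF hol(3) that] .
  show ?thesis
  proof (cases "\<exists>x y. q x < 0 \<and> q y < 0 \<and> orth x y")
    case True
    then obtain x y where xy: "q x < 0" "q y < 0" "orth x y" by blast
    have q_comb: "q (a *s x + b *s y) = (cmod a)\<^sup>2 * q x + (cmod b)\<^sup>2 * q y" for a b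
      using difference_form_orthogonal xy(3) unfolding q_def orth_def by blast
    \<comment> \<open>Large enough that \<open>- s q\<close> dominates the squared norm on the span of \<open>x\<close> and \<open>y\<close>.\<close>
    define s where "s = 2 * ((norm x)\<^sup>2 / (- q x) + (norm y)\<^sup>2 / (- q y))"
    have s0: "s \<ge> 0"
      unfolding s_def using xy by (intro mult_nonneg_nonneg add_nonneg_nonneg divide_nonneg_nonneg) auto
    have sx: "2 * (norm x)\<^sup>2 \<le> s * (- q x)" and sy: "2 * (norm y)\<^sup>2 \<le> s * (- q y)"
    proof -
      have "0 \<le> (norm x)\<^sup>2 / (- q x)" "0 \<le> (norm y)\<^sup>2 / (- q y)"
        using xy by (intro divide_nonneg_nonneg; simp)+
      then have "2 * ((norm x)\<^sup>2 / (- q x)) \<le> s" "2 * ((norm y)\<^sup>2 / (- q y)) \<le> s"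
        unfolding s_def by (simp_all add: distrib_left)
      from mult_right_mono[OF this(1), of "- q x"] mult_right_mono[OF this(2), of "- q y"]
      show "2 * (norm x)\<^sup>2 \<le> s * (- q x)" "2 * (norm y)\<^sup>2 \<le> s * (- q y)"
        using xy by auto
    qed
    have norm_comb: "(norm (a *s x + b *s y))\<^sup>2 \<le> - s * q (a *s x + b *s y)" for a b
    proof -
      have ns: "norm (c *s u) = cmod c * norm u" for c and u :: "complex ^ 'm"
        by (simp add: norm_vec_def L2_set_def norm_mult power_mult_distrib flip: sum_distrib_left)
           (simp add: real_sqrt_mult)
      have "(norm (a *s x + b *s y))\<^sup>2 \<le> (cmod a * norm x + cmod b * norm y)\<^sup>2"
        using norm_triangle_ineq[of "a *s x" "b *s y"] by (simp add: ns power_mono)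
      also have "\<dots> \<le> 2 * (cmod a * norm x)\<^sup>2 + 2 * (cmod b * norm y)\<^sup>2"
        using zero_le_power2[of "cmod a * norm x - cmod b * norm y"] by (simp add: power2_eq_square algebra_simps)
      also have "\<dots> = (cmod a)\<^sup>2 * (2 * (norm x)\<^sup>2) + (cmod b)\<^sup>2 * (2 * (norm y)\<^sup>2)"
        by (simp add: power_mult_distrib)
      also have "\<dots> \<le> (cmod a)\<^sup>2 * (s * (- q x)) + (cmod b)\<^sup>2 * (s * (- q y))"
        by (intro add_mono mult_left_mono sx sy) auto
      also have "\<dots> = - s * q (a *s x + b *s y)"
        unfolding q_comb by (simp add: algebra_simps)
      finally show ?thesis .
    qed
    have levi: "\<exists>v. v \<noteq> 0 \<and> 0 \<le> (- s) * (norm (vec_derivative f z v))\<^sup>2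
        + s * (norm (vec_derivative g z v))\<^sup>2 + (-1) * (norm (vec_derivative h z v))\<^sup>2"
      if z: "z \<in> ball 0 1" for z
    proof -
      \<comment> \<open>A kernel vector exists as \<open>n + 2 > m\<close>. It has \<open>v \<noteq> 0\<close>, as \<open>x\<close> and \<open>y\<close> are independent.\<close>
      define T where "T = (\<lambda>(v, a, b). vec_derivative h z v - (a *s x + b *s y))"
      have "linear T"
        using linD[OF z] unfolding T_def
        by (auto simp: linear_iff vec_eq_iff algebra_simps)
      moreover have "DIM(complex ^ 'm) < DIM((complex ^ 'n) \<times> complex \<times> complex)"
        using m by (simp add: DIM_complex)
      ultimately obtain v a b where vab: "(v, a, b) \<noteq> 0" "T (v, a, b) = 0"
        using exists_kernel_vector[of T] by (metis prod_cases3)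
      have Dv: "vec_derivative h z v = a *s x + b *s y"
        using vab(2) by (simp add: T_def)
      have "v \<noteq> 0"
      proof
        assume "v = 0"
        then have "a *s x + b *s y = 0" using Dv linear_0[OF linD[OF z]] by simp
        then have "(cmod a)\<^sup>2 * q x + (cmod b)\<^sup>2 * q y = 0"
          using q_comb[of a b] by (simp add: q_def)
        moreover have "(cmod a)\<^sup>2 * q x \<le> 0" "(cmod b)\<^sup>2 * q y \<le> 0"
          using xy by (auto intro: mult_nonneg_nonpos)
        ultimately have "(cmod a)\<^sup>2 * q x = 0" "(cmod b)\<^sup>2 * q y = 0" by linarith+
        then have "a = 0" "b = 0" using xy by auto
        then show False using vab(1) \<open>v = 0\<close> by (simp add: zero_prod_def)
      qed
      moreover have "0 \<le> (- s) * (norm (vec_derivative f z v))\<^sup>2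
        + s * (norm (vec_derivative g z v))\<^sup>2 + (-1) * (norm (vec_derivative h z v))\<^sup>2"
        using norm_comb[of a b] unfolding Df[OF z] Dg[OF z] Dv q_def by (simp add: algebra_simps)
      ultimately show ?thesis by blast
    qed
    have bdry: "\<exists>r<1. \<forall>z\<in>ball 0 1. r < norm z \<longrightarrow>
        (- s) * (norm (f z))\<^sup>2 + s * (norm (g z))\<^sup>2 + (-1) * (norm (h z))\<^sup>2 < -1 + e"
      if e: "e > 0" for e
    proof -
      \<comment> \<open>The error is \<open>s d\<close> from \<open>s (\<parallel>g\<parallel>\<^sup>2 - \<parallel>f\<parallel>\<^sup>2)\<close> and \<open>d\<close> from \<open>\<parallel>h\<parallel>\<^sup>2\<close>.\<close>
      define d where "d = e / (s + 1)"
      have "d > 0" using e s0 by (simp add: d_def)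
      moreover have "(s + 1) * d = e" using s0 by (simp add: d_def)
      ultimately have d: "d > 0" "s * d + d = e" by (auto simp: algebra_simps)
      obtain r where r: "r < 1" "\<And>z. z \<in> ball 0 1 \<Longrightarrow> r < norm z \<Longrightarrow> 1 - d < (norm (f z))\<^sup>2 \<and> (norm (f z))\<^sup>2 < 1
        \<and> 1 - d < (norm (g z))\<^sup>2 \<and> (norm (g z))\<^sup>2 < 1"
        by (rule sphere_preserving_pair[OF sph d(1)]) blast
      have "(- s) * (norm (f z))\<^sup>2 + s * (norm (g z))\<^sup>2 + (-1) * (norm (h z))\<^sup>2 < -1 + e"
        if zz: "z \<in> ball 0 1" "r < norm z" for z
      proof -
        have "s * ((norm (g z))\<^sup>2 - (norm (f z))\<^sup>2) \<le> s * d"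
          using r(2)[OF zz] s0 by (intro mult_left_mono) auto
        moreover have "(norm (h z))\<^sup>2 > 1 - d"
          using r(2)[OF zz] avg[OF zz(1)] by linarith
        ultimately show ?thesis using d(2) by (simp add: algebra_simps)
      qed
      with r(1) show ?thesis by blast
    qed
    have "0 \<in> ball (0::complex ^ 'n) 1" by simp
    from three_maps_maximum_principle[OF hol levi bdry this] A[OF this] B[OF this] h0
    have False by simp
    then show ?thesis ..
  next
    case False
    have levi: "\<exists>v. v \<noteq> 0 \<and> 0 \<le> 1 * (norm (vec_derivative f z v))\<^sup>2
        + (-1) * (norm (vec_derivative g z v))\<^sup>2 + 0 * (norm (vec_derivative h z v))\<^sup>2"
      if z: "z \<in> ball 0 1" for z
    proof -
      have "\<exists>v. v \<noteq> 0 \<and> 0 \<le> q (vec_derivative h z v)"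
      proof (cases "\<exists>x. q x < 0")
        case True
        then obtain x where x: "q x < 0" by blast
        \<comment> \<open>The vectors \<open>v\<close> whose image is \<open>q\<close>-orthogonal to \<open>x\<close>; one equation in \<open>n \<ge> 2\<close> unknowns.\<close>
        define T where "T = (\<lambda>v. herm (A *v vec_derivative h z v) (A *v x) - herm (B *v vec_derivative h z v) (B *v x))"
        have sc: "r *\<^sub>R u = of_real r *s u" for r and u :: "complex ^ 'q::finite"
          by (simp add: vec_eq_iff scaleR_conv_of_real[where 'a = complex])
        have "linear T"
          using linD[OF z] unfolding T_def linear_iff
          by (simp add: sc vec.add vec.scale herm_add_left herm_scale_left ring_distribs
              scaleR_conv_of_real[where 'a = complex])
        moreover have "DIM(complex) < DIM(complex ^ 'n)" using n by simp
        ultimately obtain v where v: "v \<noteq> 0" "T v = 0"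
          using exists_kernel_vector[of T] by blast
        then have "orth (vec_derivative h z v) x" by (simp add: orth_def T_def)
        then have "0 \<le> q (vec_derivative h z v)" using False x by (meson not_less)
        with v show ?thesis by blast
      next
        case False
        moreover have "axis undefined 1 \<noteq> (0 :: complex ^ 'n)" by (simp add: axis_eq_0_iff)
        ultimately show ?thesis by (meson not_less)
      qed
      then show ?thesis
        unfolding Df[OF z] Dg[OF z] q_def by simp
    qed
    have bdry: "\<exists>r<1. \<forall>z\<in>ball 0 1. r < norm z \<longrightarrow>
        1 * (norm (f z))\<^sup>2 + (-1) * (norm (g z))\<^sup>2 + 0 * (norm (h z))\<^sup>2 < 0 + e"
      if e: "e > 0" for e
    proof -
      obtain r where r: "r < 1" "\<And>z. z \<in> ball 0 1 \<Longrightarrow> r < norm z \<Longrightarrow> 1 - e < (norm (f z))\<^sup>2 \<and> (norm (f z))\<^sup>2 < 1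
        \<and> 1 - e < (norm (g z))\<^sup>2 \<and> (norm (g z))\<^sup>2 < 1"
        by (rule sphere_preserving_pair[OF sph e]) blast
      have "1 * (norm (f z))\<^sup>2 + (-1) * (norm (g z))\<^sup>2 + 0 * (norm (h z))\<^sup>2 < 0 + e"
        if zz: "z \<in> ball 0 1" "r < norm z" for z
        using r(2)[OF zz] by simp
      with r(1) show ?thesis by blast
    qed
    from three_maps_maximum_principle[OF hol levi bdry z]
    show ?thesis by simp
  qed
qed

lemma averaged_sphere_maps_norm_eq:
  fixes f g h :: "complex ^ 'n::finite \<Rightarrow> complex ^ 'm::finite"
  assumes "CARD('n) \<ge> 2" "CARD('m) < CARD('n) + 2"
    and "holomorphic_vec_on f (ball 0 1)" "holomorphic_vec_on g (ball 0 1)" "holomorphic_vec_on h (ball 0 1)"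
    and "sphere_preserving f" "sphere_preserving g"
    and avg: "\<And>z. z \<in> ball 0 1 \<Longrightarrow> 2 * (norm (h z))\<^sup>2 = (norm (f z))\<^sup>2 + (norm (g z))\<^sup>2"
    and "h 0 = 0" and "z \<in> ball 0 1"
  shows "(norm (f z))\<^sup>2 = (norm (g z))\<^sup>2"
proof (rule antisym)
  show "(norm (f z))\<^sup>2 \<le> (norm (g z))\<^sup>2"
    by (rule averaged_sphere_maps_norm_le[OF assms])
  have "2 * (norm (h z))\<^sup>2 = (norm (g z))\<^sup>2 + (norm (f z))\<^sup>2" if "z \<in> ball 0 1" for z
    using avg[OF that] by simp
  from averaged_sphere_maps_norm_le[OF assms(1,2,4,3,5,7,6) this assms(9,10)]
  show "(norm (g z))\<^sup>2 \<le> (norm (f z))\<^sup>2" .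
qed

section \<open>Properness in terms of norms\<close>

lemma norm_sq_cspace: "w \<in> cspace N \<Longrightarrow> norm_sq w = (\<Sum>j<N. (cmod (w j))\<^sup>2)"
  unfolding norm_sq_def by (rule suminf_finite) (auto simp: cspace_def)

lemma continuous_on_norm_sq: "continuous_on (cspace N) norm_sq"
proof -
  have "continuous_on (cspace N) (\<lambda>w. \<Sum>j<N. (cmod (w j))\<^sup>2)"
    by (intro continuous_intros continuous_on_subset[OF continuous_on_product_coordinates]) auto
  then show ?thesis
    by (rule continuous_on_eq) (simp add: norm_sq_cspace)
qed

text \<open>
  By Tychonoff's theorem, since this is a closed subset of a product of discs.
\<close>

lemma compact_norm_sq_le: "compact {w \<in> cspace N. norm_sq w \<le> c}"
proof -
  define D where "D = PiE UNIV (\<lambda>j::nat. cball (0::complex) (sqrt c))"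
  have "compactin (product_topology (\<lambda>j::nat. euclidean :: complex topology) UNIV) D"
    unfolding D_def by (simp add: compactin_PiE)
  then have "compact D" by (simp add: euclidean_product_topology)
  moreover have "closed {w :: nat \<Rightarrow> complex. (\<forall>j\<ge>N. w j = 0) \<and> (\<Sum>j<N. (cmod (w j))\<^sup>2) \<le> c}"
    by (intro closed_Collect_conj closed_Collect_all closed_Collect_imp closed_Collect_eq closed_Collect_le
        continuous_intros open_Collect_const) auto
  ultimately have "compact (D \<inter> {w. (\<forall>j\<ge>N. w j = 0) \<and> (\<Sum>j<N. (cmod (w j))\<^sup>2) \<le> c})"
    by (rule compact_Int_closed)
  also have "D \<inter> {w. (\<forall>j\<ge>N. w j = 0) \<and> (\<Sum>j<N. (cmod (w j))\<^sup>2) \<le> c} = {w \<in> cspace N. norm_sq w \<le> c}"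
  proof (intro equalityI subsetI)
    fix w assume w: "w \<in> {w \<in> cspace N. norm_sq w \<le> c}"
    then have s: "(\<Sum>j<N. (cmod (w j))\<^sup>2) \<le> c" using norm_sq_cspace[of w N] by auto
    have "cmod (w j) \<le> sqrt c" for j
    proof (cases "j < N")
      case True
      then have "(cmod (w j))\<^sup>2 \<le> (\<Sum>j<N. (cmod (w j))\<^sup>2)"
        by (intro member_le_sum) auto
      then show ?thesis using s by (intro real_le_rsqrt) simp
    next
      case False
      have "0 \<le> c" using s by (meson order_trans sum_nonneg zero_le_power2)
      then show ?thesis using False w by (simp add: cspace_def)
    qed
    then show "w \<in> D \<inter> {w. (\<forall>j\<ge>N. w j = 0) \<and> (\<Sum>j<N. (cmod (w j))\<^sup>2) \<le> c}"
      using w s by (auto simp: D_def cspace_def)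
  next
    fix w assume w: "w \<in> D \<inter> {w. (\<forall>j\<ge>N. w j = 0) \<and> (\<Sum>j<N. (cmod (w j))\<^sup>2) \<le> c}"
    then have c: "w \<in> cspace N" by (simp add: cspace_def)
    show "w \<in> {w \<in> cspace N. norm_sq w \<le> c}" using w c by (simp add: norm_sq_cspace[OF c])
  qed
  finally show ?thesis .
qed

lemma holomorphic_ball_map_continuous:
  assumes "holomorphic_ball_map N f"
  shows "continuous_on (ball 0 1) f"
proof (rule continuous_on_coordinatewise_then_product)
  fix j
  show "continuous_on (ball 0 1) (\<lambda>z. f z j)"
  proof (cases "j < N")
    case True
    then show ?thesis
      using assms by (intro holomorphic_fun_on_continuous) (simp add: holomorphic_ball_map_def)
  next
    case False
    then have "\<And>z. z \<in> ball 0 1 \<Longrightarrow> f z j = 0"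
      using assms by (force simp: holomorphic_ball_map_def cspace_def)
    then show ?thesis
      using continuous_on_cong[of "ball 0 1" "ball 0 1" "\<lambda>z. f z j" "\<lambda>_. 0"] by simp
  qed
qed

text \<open>
  The sets \<open>norm_sq w \<le> 1 - e\<close> are compact and exhaust the target ball, so it suffices to look at
  their preimages. These are compact exactly when they stay away from the unit sphere.
\<close>

lemma proper_holomorphic_iff:
  "proper_holomorphic N f \<longleftrightarrow> holomorphic_ball_map N f \<and> (\<forall>z\<in>ball 0 1. norm_sq (f z) < 1) \<and>
     (\<forall>e>0. \<exists>r<1. \<forall>z\<in>ball 0 1. r < norm z \<longrightarrow> 1 - e < norm_sq (f z))" (is "_ \<longleftrightarrow> ?R")
proof
  assume p: "proper_holomorphic N f"
  then have hol: "holomorphic_ball_map N f" and im: "f ` ball 0 1 \<subseteq> target_ball N"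
    and pm: "proper_map (top_of_set (ball 0 1)) (top_of_set (target_ball N)) f"
    by (auto simp: proper_holomorphic_def)
  have "\<exists>r<1. \<forall>z\<in>ball 0 1. r < norm z \<longrightarrow> 1 - e < norm_sq (f z)" if e: "e > 0" for e
  proof -
    define K where "K = {w \<in> cspace N. norm_sq w \<le> 1 - e}"
    define P where "P = {z \<in> ball 0 1. f z \<in> K}"
    have "compactin (top_of_set (target_ball N)) K"
      using compact_norm_sq_le e by (auto simp: K_def compactin_subtopology target_ball_def)
    from compactin_proper_map_preimage[OF pm this]
    have "compactin (top_of_set (ball 0 1)) P"
      by (simp add: P_def)
    then have P: "compact P" "P \<subseteq> ball 0 1"
      by (auto simp: compactin_subtopology)
    have gt: "1 - e < norm_sq (f z)" if "z \<in> ball 0 1" "z \<notin> P" for z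
      using that im by (auto simp: P_def K_def target_ball_def image_subset_iff)
    show ?thesis
    proof (cases "P = {}")
      case True
      then show ?thesis using gt by (intro exI[of _ 0]) auto
    next
      case False
      then obtain w where w: "w \<in> P" "\<And>z. z \<in> P \<Longrightarrow> norm z \<le> norm w"
        using continuous_attains_sup[OF P(1), of norm] by (auto intro: continuous_intros)
      then show ?thesis
        using gt P(2) by (intro exI[of _ "norm w"]) (force simp: not_le)
    qed
  qed
  then show ?R using hol im by (auto simp: target_ball_def)
next
  assume R: ?R
  then have hol: "holomorphic_ball_map N f" by blast
  then have im: "f ` ball 0 1 \<subseteq> target_ball N"
    using R by (auto simp: target_ball_def holomorphic_ball_map_def)
  have cont: "continuous_on (ball 0 1) f" by (rule holomorphic_ball_map_continuous[OF hol])
  have metr: "metrizable_space (top_of_set (target_ball N))"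
    by (intro metrizable_space_subtopology metrizable_space_euclidean)
  have "proper_map (top_of_set (ball 0 1)) (top_of_set (target_ball N)) f"
  proof (rule compact_imp_proper_map)
    show "k_space (top_of_set (target_ball N))" "kc_space (top_of_set (target_ball N))"
      using metr by (simp_all add: metrizable_imp_k_space metrizable_imp_Hausdorff_space Hausdorff_imp_kc_space)
    show "f \<in> topspace (top_of_set (ball 0 1)) \<rightarrow> topspace (top_of_set (target_ball N))"
      using im by auto
    show "continuous_map (top_of_set (ball 0 1)) (top_of_set (target_ball N)) f \<or> kc_space (top_of_set (ball (0::complex^'a) 1))"
      using cont im by auto
    fix K assume "compactin (top_of_set (target_ball N)) K"
    then have K: "compact K" "K \<subseteq> target_ball N" by (auto simp: compactin_subtopology)
    have "compact {z \<in> ball 0 1. f z \<in> K}"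
    proof (cases "K = {}")
      case False
      have "continuous_on K norm_sq"
        by (rule continuous_on_subset[OF continuous_on_norm_sq]) (use K in \<open>auto simp: target_ball_def\<close>)
      then obtain w where w: "w \<in> K" "\<And>x. x \<in> K \<Longrightarrow> norm_sq x \<le> norm_sq w"
        using continuous_attains_sup[OF K(1) False] by blast
      have "1 - norm_sq w > 0" using w K by (auto simp: target_ball_def)
      then obtain r where r: "r < 1" "\<And>z. z \<in> ball 0 1 \<Longrightarrow> r < norm z \<Longrightarrow> 1 - (1 - norm_sq w) < norm_sq (f z)"
        using R by meson
      have eq: "{z \<in> ball 0 1. f z \<in> K} = cball 0 r \<inter> f -` K"
      proof (intro equalityI subsetI)
        fix z assume "z \<in> {z \<in> ball 0 1. f z \<in> K}"
        then show "z \<in> cball 0 r \<inter> f -` K"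
          using r(2)[of z] w(2)[of "f z"] by force
      qed (use r(1) in auto)
      have "closedin (top_of_set (cball 0 r)) (cball 0 r \<inter> f -` K)"
        using r(1) by (intro continuous_closedin_preimage continuous_on_subset[OF cont] compact_imp_closed K(1)) auto
      then show ?thesis
        unfolding eq using closedin_compact compact_cball by blast
    qed auto
    then show "compactin (top_of_set (ball 0 1)) {x \<in> topspace (top_of_set (ball 0 1)). f x \<in> K}"
      by (auto simp: compactin_subtopology)
  qed
  then show "proper_holomorphic N f"
    using hol im by (simp add: proper_holomorphic_def)
qed

section \<open>Convex families\<close>

text \<open>
  The orthogonal sum \<open>a f \<oplus> b g\<close>, with the components of \<open>g\<close> placed from index \<open>N\<close> on. It realizes
  \<open>a\<^sup>2 \<parallel>f\<parallel>\<^sup>2 + b\<^sup>2 \<parallel>g\<parallel>\<^sup>2\<close> as a squared norm.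
\<close>

definition direct_sum :: "nat \<Rightarrow> real \<Rightarrow> real \<Rightarrow> 'n::finite mapping \<Rightarrow> 'n mapping \<Rightarrow> 'n mapping" where
  "direct_sum N a b f g z j = (if j < N then of_real a * f z j else of_real b * g z (j - N))"

lemma holomorphic_fun_on_scale:
  assumes "holomorphic_fun_on \<phi> S"
  shows "holomorphic_fun_on (\<lambda>z. c * \<phi> z) S"
  unfolding holomorphic_fun_on_def
proof
  fix z assume z: "z \<in> S"
  note D = frechet_derivative_holomorphic[OF assms z]
  show "\<exists>L. ((\<lambda>z. c * \<phi> z) has_derivative L) (at z) \<and> (\<forall>c v. L (c *s v) = c * L v)"
    by (rule exI, rule conjI, rule has_derivative_mult_right[OF D(1)]) (simp add: D(2))
qed

lemma
  assumes f: "holomorphic_ball_map N f" and g: "holomorphic_ball_map M g"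
  shows holomorphic_direct_sum: "holomorphic_ball_map (N + M) (direct_sum N a b f g)"
    and norm_sq_direct_sum:
      "z \<in> ball 0 1 \<Longrightarrow> norm_sq (direct_sum N a b f g z) = a\<^sup>2 * norm_sq (f z) + b\<^sup>2 * norm_sq (g z)"
proof -
  have fc: "f z \<in> cspace N" and gc: "g z \<in> cspace M" if "z \<in> ball 0 1" for z
    using f g that by (auto simp: holomorphic_ball_map_def)
  have sc: "direct_sum N a b f g z \<in> cspace (N + M)" if "z \<in> ball 0 1" for z
    using gc[OF that] by (auto simp: cspace_def direct_sum_def)
  show "holomorphic_ball_map (N + M) (direct_sum N a b f g)"
    unfolding holomorphic_ball_map_def
  proof (intro conjI allI impI)
    fix j assume "j < N + M"
    then show "holomorphic_fun_on (\<lambda>z. direct_sum N a b f g z j) (ball 0 1)"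
      using f g by (cases "j < N") (auto simp: direct_sum_def holomorphic_ball_map_def intro!: holomorphic_fun_on_scale)
  qed (use sc in auto)
  have split: "(\<Sum>j<N + M. F j) = (\<Sum>j<N. F j) + (\<Sum>j<M. F (N + j))" for F :: "nat \<Rightarrow> real"
    by (induction M) (auto simp: add.assoc)
  show "norm_sq (direct_sum N a b f g z) = a\<^sup>2 * norm_sq (f z) + b\<^sup>2 * norm_sq (g z)" if z: "z \<in> ball 0 1"
    unfolding norm_sq_cspace[OF sc[OF z]] norm_sq_cspace[OF fc[OF z]] norm_sq_cspace[OF gc[OF z]] split
    by (simp add: direct_sum_def norm_mult power_mult_distrib sum_distrib_left)
qed

lemma proper_holomorphic_direct_sum:
  assumes f: "proper_holomorphic N f" and g: "proper_holomorphic M g" and ab: "a\<^sup>2 + b\<^sup>2 = 1"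
  shows "proper_holomorphic (N + M) (direct_sum N a b f g)"
proof -
  have hf: "holomorphic_ball_map N f" and hg: "holomorphic_ball_map M g"
    using f g by (auto simp: proper_holomorphic_def)
  note ns = norm_sq_direct_sum[OF hf hg]
  have conv: "x < y \<Longrightarrow> x' < y \<Longrightarrow> a\<^sup>2 * x + b\<^sup>2 * x' < y"
    "y < x \<Longrightarrow> y < x' \<Longrightarrow> y < a\<^sup>2 * x + b\<^sup>2 * x'" for x x' y :: real
    using convex_bound_lt[of x y x' "a\<^sup>2" "b\<^sup>2"] convex_bound_lt[of "-x" "-y" "-x'" "a\<^sup>2" "b\<^sup>2"] ab by auto
  show ?thesis
    unfolding proper_holomorphic_iff
  proof (intro conjI ballI allI impI)
    show "holomorphic_ball_map (N + M) (direct_sum N a b f g)"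
      by (rule holomorphic_direct_sum[OF hf hg])
    show "norm_sq (direct_sum N a b f g z) < 1" if "z \<in> ball 0 1" for z
      unfolding ns[OF that] using f g that by (intro conv) (auto simp: proper_holomorphic_iff)
    fix e :: real assume "e > 0"
    then obtain r s where "r < 1" "s < 1" "\<forall>z\<in>ball 0 1. r < norm z \<longrightarrow> 1 - e < norm_sq (f z)"
      "\<forall>z\<in>ball 0 1. s < norm z \<longrightarrow> 1 - e < norm_sq (g z)"
      using f g unfolding proper_holomorphic_iff by blast
    then show "\<exists>r<1. \<forall>z\<in>ball 0 1. r < norm z \<longrightarrow> 1 - e < norm_sq (direct_sum N a b f g z)"
      by (intro exI[of _ "max r s"]) (auto simp: ns intro!: conv)
  qed
qed

lemma P_infinity_combination:
  assumes "P_infinity R" "P_infinity R'" "u \<ge> 0" "v \<ge> 0"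
    and "\<And>z. z \<in> ball 0 1 \<Longrightarrow> Q z = u * R z + v * R' z"
  shows "P_infinity Q"
proof -
  obtain N f M g where fg: "holomorphic_ball_map N f" "\<forall>z\<in>ball 0 1. R z = norm_sq (f z)"
    "holomorphic_ball_map M g" "\<forall>z\<in>ball 0 1. R' z = norm_sq (g z)"
    using assms unfolding P_infinity_def by blast
  then show ?thesis
    unfolding P_infinity_def
    using holomorphic_direct_sum[OF fg(1,3)] norm_sq_direct_sum[OF fg(1,3), of _ "sqrt u" "sqrt v"] assms
    by (intro exI[of _ "N + M"] exI[of _ "direct_sum N (sqrt u) (sqrt v) f g"]) auto
qed

text \<open>
  The set of all admissible parameters is convex, because \<^const>\<open>P_infinity\<close> is a convex
  cone and \<^const>\<open>family_fun\<close> is affine in the parameter.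
\<close>

lemma parameter_set_eq: "parameter_set f = {t. P_infinity (family_fun f t)}"
  unfolding parameter_set_def
proof (rule Greatest_equality)
  have "convex {t. P_infinity (family_fun f t)}"
    unfolding convex_def
  proof (intro ballI allI impI)
    fix s t and u v :: real
    assume *: "s \<in> {t. P_infinity (family_fun f t)}" "t \<in> {t. P_infinity (family_fun f t)}"
      "0 \<le> u" "0 \<le> v" "u + v = 1"
    have v: "v = 1 - u" using * by simp
    have "family_fun f (u *\<^sub>R s + v *\<^sub>R t) z = u * family_fun f s z + v * family_fun f t z" for z
    proof -
      have 1: "(\<Sum>j\<in>UNIV. (u * s $ j + v * t $ j) * c j)
          = u * (\<Sum>j\<in>UNIV. s $ j * c j) + v * (\<Sum>j\<in>UNIV. t $ j * c j)" for c
        by (simp add: sum.distrib sum_distrib_left algebra_simps)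
      have 2: "(\<Sum>j\<in>UNIV. u * s $ j + v * t $ j) = u * (\<Sum>j\<in>UNIV. s $ j) + v * (\<Sum>j\<in>UNIV. t $ j)"
        using 1[of "\<lambda>_. 1"] by simp
      show ?thesis
        unfolding family_fun_def vector_add_component vector_scaleR_component real_scaleR_def 1 2
        by (simp add: v algebra_simps)
    qed
    with * show "u *\<^sub>R s + v *\<^sub>R t \<in> {t. P_infinity (family_fun f t)}"
      using P_infinity_combination[of "family_fun f s" "family_fun f t" u v] by auto
  qed
  then show "convex {t. P_infinity (family_fun f t)} \<and> (\<forall>t\<in>{t. P_infinity (family_fun f t)}. P_infinity (family_fun f t))"
    by simp
qed auto

text \<open>
  The condition that singles out the coefficients only concerns arbitrarily small balls around the origin.
\<close>

lemma underlying_form_cong: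
  fixes R R' :: "complex ^ 'n::finite \<Rightarrow> real"
  assumes eq: "\<And>z. z \<in> ball 0 1 \<Longrightarrow> R z = R' z"
  shows "underlying_form R = underlying_form R'"
proof -
  define E :: "(('n \<Rightarrow> nat) \<Rightarrow> ('n \<Rightarrow> nat) \<Rightarrow> complex) \<Rightarrow> complex ^ 'n \<Rightarrow> real \<Rightarrow> bool"
    where "E = (\<lambda>c z x. ((\<lambda>(\<alpha>, \<beta>). c \<alpha> \<beta> * monomial z \<alpha> * cnj (monomial z \<beta>))
                 has_sum complex_of_real x) UNIV)"
  have form: "underlying_form Q = (THE c. \<exists>r>0. \<forall>z\<in>ball 0 r. E c z (Q z))" for Q
    unfolding underlying_form_def E_def ..
  have shrink: "\<exists>r>0. \<forall>z\<in>ball 0 r. E c z (Q' z)"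
    if "\<exists>r>0. \<forall>z\<in>ball 0 r. E c z (Q z)" and QQ': "\<And>z. z \<in> ball 0 1 \<Longrightarrow> Q z = Q' z" for Q Q' c
  proof -
    from that(1) obtain r where r: "r > 0" "\<forall>z\<in>ball 0 r. E c z (Q z)"
      by (elim exE conjE)
    have "E c z (Q' z)" if z: "z \<in> ball 0 (min r 1)" for z
    proof -
      have "E c z (Q z)" by (rule bspec[OF r(2)]) (use z in simp)
      moreover have "Q z = Q' z" by (rule QQ') (use z in simp)
      ultimately show ?thesis by simp
    qed
    then show ?thesis
      by (intro exI[of _ "min r 1"] conjI ballI) (simp add: r(1))
  qed
  have "(\<exists>r>0. \<forall>z\<in>ball 0 r. E c z (R z)) \<longleftrightarrow> (\<exists>r>0. \<forall>z\<in>ball 0 r. E c z (R' z))" for c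
  proof
    assume "\<exists>r>0. \<forall>z\<in>ball 0 r. E c z (R z)"
    then show "\<exists>r>0. \<forall>z\<in>ball 0 r. E c z (R' z)" by (rule shrink) (rule eq)
  next
    assume "\<exists>r>0. \<forall>z\<in>ball 0 r. E c z (R' z)"
    then show "\<exists>r>0. \<forall>z\<in>ball 0 r. E c z (R z)" by (rule shrink) (rule eq[symmetric])
  qed
  then show ?thesis
    unfolding form by simp
qed

text \<open>
  Otherwise the two forms coincide, and their difference is a nontrivial linear relation.
\<close>

lemma independent_forms_differ:
  assumes "independent_forms f" "i \<noteq> j"
  shows "\<exists>z\<in>ball 0 1. norm_sq (f i z) \<noteq> norm_sq (f j z)"
proof (rule ccontr)
  assume "\<not> ?thesis"
  then have eq: "\<And>z. z \<in> ball 0 1 \<Longrightarrow> norm_sq (f i z) = norm_sq (f j z)" by blast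
  have form: "underlying_form (\<lambda>z. norm_sq (f i z)) = underlying_form (\<lambda>z. norm_sq (f j z))"
    by (rule underlying_form_cong[OF eq])
  define a :: "'a \<Rightarrow> real" where "a = (\<lambda>l. if l = i then 1 else if l = j then -1 else 0)"
  have "(\<Sum>l\<in>UNIV. of_real (a l) * underlying_form (\<lambda>z. norm_sq (f l z)) \<alpha> \<beta>) = 0" for \<alpha> \<beta>
  proof -
    have "(\<Sum>l\<in>UNIV. of_real (a l) * underlying_form (\<lambda>z. norm_sq (f l z)) \<alpha> \<beta>)
        = (\<Sum>l\<in>{i, j}. of_real (a l) * underlying_form (\<lambda>z. norm_sq (f l z)) \<alpha> \<beta>)"
      by (rule sum.mono_neutral_right) (auto simp: a_def)
    also have "\<dots> = 0" using assms(2) by (simp add: a_def form)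
    finally show ?thesis .
  qed
  then have "a i = 0"
    using assms(1) unfolding independent_forms_def by blast
  then show False by (simp add: a_def)
qed

text \<open>
  A finite type of size at least \<open>N\<close> can index the first components of the map; the surplus ones
  vanish on the ball.
\<close>

lemma proper_holomorphic_vector_model:
  fixes f :: "'n::finite mapping"
  assumes f: "proper_holomorphic N f" and N: "N \<le> CARD('m::finite)"
  obtains f' :: "complex ^ 'n \<Rightarrow> complex ^ 'm" where "holomorphic_vec_on f' (ball 0 1)" "sphere_preserving f'"
    "\<And>z. z \<in> ball 0 1 \<Longrightarrow> (norm (f' z))\<^sup>2 = norm_sq (f z)"
proof -
  obtain k :: "'m \<Rightarrow> nat" where k: "bij_betw k UNIV {0..<CARD('m)}"
    using ex_bij_betw_finite_nat[OF finite_class.finite_UNIV] by blast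
  define f' :: "complex ^ 'n \<Rightarrow> complex ^ 'm" where "f' = (\<lambda>z. \<chi> i. f z (k i))"
  have hol: "holomorphic_ball_map N f" using f by (simp add: proper_holomorphic_def)
  have cs: "f z \<in> cspace N" if "z \<in> ball 0 1" for z
    using hol that by (auto simp: holomorphic_ball_map_def)
  have norm: "(norm (f' z))\<^sup>2 = norm_sq (f z)" if z: "z \<in> ball 0 1" for z
  proof -
    have "(norm (f' z))\<^sup>2 = (\<Sum>j\<in>{0..<CARD('m)}. (cmod (f z j))\<^sup>2)"
      by (simp add: norm_sq_vec f'_def sum.reindex_bij_betw[OF k, of "\<lambda>j. (cmod (f z j))\<^sup>2"])
    also have "\<dots> = (\<Sum>j<N. (cmod (f z j))\<^sup>2)"
      using N cs[OF z] by (intro sum.mono_neutral_right) (auto simp: cspace_def)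
    finally show ?thesis using norm_sq_cspace[OF cs[OF z]] by simp
  qed
  have "holomorphic_fun_on (\<lambda>z. f z j) (ball 0 1)" for j
  proof (cases "j < N")
    case True
    then show ?thesis using hol by (simp add: holomorphic_ball_map_def)
  next
    case False
    show ?thesis
      unfolding holomorphic_fun_on_def
    proof
      fix z :: "complex ^ 'n" assume z: "z \<in> ball 0 1"
      have "((\<lambda>z. f z j) has_derivative (\<lambda>v. 0)) (at z)"
        by (rule has_derivative_transform_within_open[OF has_derivative_const[of 0] open_ball z])
          (use cs False in \<open>auto simp: cspace_def\<close>)
      then show "\<exists>L. ((\<lambda>z. f z j) has_derivative L) (at z) \<and> (\<forall>c v. L (c *s v) = c * L v)"
        by (intro exI[of _ "\<lambda>v. 0"]) simp
    qed
  qed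
  then have "holomorphic_vec_on f' (ball 0 1)"
    by (simp add: holomorphic_vec_on_def f'_def)
  moreover have "sphere_preserving f'"
    unfolding sphere_preserving_def
  proof (intro conjI ballI allI impI)
    show "norm (f' z) < 1" if "z \<in> ball 0 1" for z
    proof -
      have "(norm (f' z))\<^sup>2 < 1" using f norm[OF that] that by (simp add: proper_holomorphic_iff)
      then show ?thesis by (simp add: power_less_one_iff)
    qed
    show "\<exists>r<1. \<forall>z\<in>ball 0 1. r < norm z \<longrightarrow> 1 - e < (norm (f' z))\<^sup>2" if "e > 0" for e
      using f norm that unfolding proper_holomorphic_iff by simp
  qed
  ultimately show thesis using norm that by blast
qed

text \<open>
  The endpoints \<open>f\<close>, \<open>g\<close> of a segment of the family and its midpoint \<open>h\<close> are members, so each is norm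
  equivalent to a map into \<open>B\<^sub>N\<close>. If \<open>N < n + 2\<close>, the type \<open>'n option\<close>, of size \<open>n + 1\<close>, can
  index the target space of all three maps.
\<close>

lemma convex_family_target_dimension:
  fixes F :: "'n::finite mapping set"
  assumes n: "CARD('n) \<ge> 2" and F: "convex_family TYPE('k::finite) F" "maps_to_ball N F" "origin_preserving F"
  shows "N \<ge> CARD('n) + 2"
proof (rule ccontr)
  assume "\<not> ?thesis"
  then have N: "N \<le> CARD('n option)" by simp
  obtain \<Phi> :: "'k option \<Rightarrow> 'n mapping" where proper: "\<And>i. \<exists>M. proper_holomorphic M (\<Phi> i)"
    and indep: "independent_forms \<Phi>" and F_eq: "F = family_members \<Phi>"
    using F(1) unfolding convex_family_def by blast
  define k :: 'k where "k = undefined"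
  define f where "f = \<Phi> None"
  define g where "g = \<Phi> (Some k)"
  obtain M where fM: "proper_holomorphic M f" using proper f_def by blast
  obtain M' where gM: "proper_holomorphic M' g" using proper g_def by blast
  define h where "h = direct_sum M (sqrt (1/2)) (sqrt (1/2)) f g"
  have hM: "proper_holomorphic (M + M') h"
    unfolding h_def by (rule proper_holomorphic_direct_sum[OF fM gM]) simp
  have h_eq: "norm_sq (h z) = (norm_sq (f z) + norm_sq (g z)) / 2" if "z \<in> ball 0 1" for z
  proof -
    have "holomorphic_ball_map M f" "holomorphic_ball_map M' g"
      using fM gM by (simp_all add: proper_holomorphic_def)
    from norm_sq_direct_sum[OF this that] show ?thesis
      by (simp add: h_def field_simps)
  qed
  have fam: "family_fun \<Phi> (axis k c) z = c * norm_sq (g z) + (1 - c) * norm_sq (f z)" for c z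
    by (simp add: family_fun_def axis_def f_def g_def if_distrib[of "\<lambda>x. x * _"] cong: if_cong)
  have member: "p \<in> F" if "proper_holomorphic L p"
    "\<And>z. z \<in> ball 0 1 \<Longrightarrow> norm_sq (p z) = c * norm_sq (g z) + (1 - c) * norm_sq (f z)" for p L c
  proof -
    have "P_infinity (family_fun \<Phi> (axis k c))"
      unfolding P_infinity_def
      by (rule exI[of _ L], rule exI[of _ p]) (use that in \<open>simp add: fam proper_holomorphic_def\<close>)
    then have "axis k c \<in> parameter_set \<Phi>" by (simp add: parameter_set_eq)
    moreover have "\<forall>z\<in>ball 0 1. norm_sq (p z) = family_fun \<Phi> (axis k c) z" using that(2) by (simp add: fam)
    ultimately show ?thesis
      unfolding F_eq family_members_def using that(1) by blast
  qed
  have fF: "f \<in> F" by (rule member[OF fM, of 0]) simp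
  have gF: "g \<in> F" by (rule member[OF gM, of 1]) simp
  have hF: "h \<in> F" by (rule member[OF hM, of "1/2"]) (simp add: h_eq)
  have model: "\<exists>p' :: complex ^ 'n \<Rightarrow> complex ^ 'n option. holomorphic_vec_on p' (ball 0 1) \<and> sphere_preserving p' \<and>
      (\<forall>z\<in>ball 0 1. (norm (p' z))\<^sup>2 = norm_sq (p z))" if "p \<in> F" for p
  proof -
    have "\<exists>p1. proper_holomorphic N p1 \<and> norm_equivalent p p1"
      by (rule bspec[OF F(2)[unfolded maps_to_ball_def] that])
    then obtain p1 where p1: "proper_holomorphic N p1" "norm_equivalent p p1"
      by (elim exE conjE)
    obtain p' :: "complex ^ 'n \<Rightarrow> complex ^ 'n option" where p': "holomorphic_vec_on p' (ball 0 1)"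
      "sphere_preserving p'" "\<And>z. z \<in> ball 0 1 \<Longrightarrow> (norm (p' z))\<^sup>2 = norm_sq (p1 z)"
      by (rule proper_holomorphic_vector_model[OF p1(1) N]) (rule that)
    have "\<forall>z\<in>ball 0 1. (norm (p' z))\<^sup>2 = norm_sq (p z)"
      using p1(2) p'(3) by (simp add: norm_equivalent_def)
    with p'(1,2) show ?thesis by blast
  qed
  obtain f' :: "complex ^ 'n \<Rightarrow> complex ^ 'n option" where f': "holomorphic_vec_on f' (ball 0 1)" "sphere_preserving f'"
    "\<And>z. z \<in> ball 0 1 \<Longrightarrow> (norm (f' z))\<^sup>2 = norm_sq (f z)" using model[OF fF] by (elim exE conjE) (rule that, auto)
  obtain g' :: "complex ^ 'n \<Rightarrow> complex ^ 'n option" where g': "holomorphic_vec_on g' (ball 0 1)" "sphere_preserving g'"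
    "\<And>z. z \<in> ball 0 1 \<Longrightarrow> (norm (g' z))\<^sup>2 = norm_sq (g z)" using model[OF gF] by (elim exE conjE) (rule that, auto)
  obtain h' :: "complex ^ 'n \<Rightarrow> complex ^ 'n option" where h': "holomorphic_vec_on h' (ball 0 1)"
    "\<And>z. z \<in> ball 0 1 \<Longrightarrow> (norm (h' z))\<^sup>2 = norm_sq (h z)" using model[OF hF] by (elim exE conjE) (rule that, auto)
  have "\<forall>j. h 0 j = 0"
    by (rule bspec[OF F(3)[unfolded origin_preserving_def] hF])
  then have "norm_sq (h 0) = 0"
    by (simp add: norm_sq_def)
  then have "(norm (h' 0))\<^sup>2 = 0" using h'(2)[of 0] by simp
  then have h'0: "h' 0 = 0" by (simp only: power_eq_0_iff norm_eq_zero)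
  have "norm_sq (f z) = norm_sq (g z)" if z: "z \<in> ball 0 1" for z
  proof -
    have card: "CARD('n option) < CARD('n) + 2" by simp
    have avg: "2 * (norm (h' z))\<^sup>2 = (norm (f' z))\<^sup>2 + (norm (g' z))\<^sup>2" if "z \<in> ball 0 1" for z
      unfolding f'(3)[OF that] g'(3)[OF that] h'(2)[OF that] h_eq[OF that] by simp
    have "(norm (f' z))\<^sup>2 = (norm (g' z))\<^sup>2"
      by (rule averaged_sphere_maps_norm_eq[OF n card f'(1) g'(1) h'(1) f'(2) g'(2) avg h'0 z])
    then show ?thesis
      unfolding f'(3)[OF z] g'(3)[OF z] .
  qed
  moreover have "\<exists>z\<in>ball 0 1. norm_sq (f z) \<noteq> norm_sq (g z)"
    unfolding f_def g_def by (rule independent_forms_differ[OF indep]) simp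
  ultimately show False by blast
qed

theorem theorem1:
  assumes "CARD('n::finite) \<ge> 2"
  shows "(\<forall>N (F :: 'n mapping set).
            convex_family TYPE('k::finite) F \<and> maps_to_ball N F \<and> origin_preserving F
              \<longrightarrow> N \<ge> CARD('n) + 2) \<and>
         \<not> (\<exists>F :: 'n mapping set.
               convex_family TYPE(1) F \<and> maps_to_ball (CARD('n) + 1) F \<and> origin_preserving F)"
proof (intro conjI allI impI notI)
  fix N and F :: "'n mapping set"
  assume "convex_family TYPE('k) F \<and> maps_to_ball N F \<and> origin_preserving F"
  then show "N \<ge> CARD('n) + 2"
    by (elim conjE) (rule convex_family_target_dimension[OF assms])
next
  assume "\<exists>F :: 'n mapping set.
    convex_family TYPE(1) F \<and> maps_to_ball (CARD('n) + 1) F \<and> origin_preserving F"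
  then show False
  proof (elim exE conjE)
    fix F :: "'n mapping set"
    assume "convex_family TYPE(1) F" "maps_to_ball (CARD('n) + 1) F" "origin_preserving F"
    from convex_family_target_dimension[OF assms this] show False by simp
  qed
qed

end
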